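(* Let $w = 1 \square 0 \square 0$, a partial word over the alphabet $\{0,1\}$ (with $\square$ denoting a missing coordinate). Then the automorphism group of the subshift $X_w \subset \{0,1\}^{\mathbb{Z}}$ is isomorphic to the group \[ \left(\left\langle (5/2)^i \;\middle|\; i \in \mathbb{N} \right\rangle, +\right) \leq (\mathbb{Q}, +), \] with the shift map $\sigma$ corresponding to the rational number $1$.
   Context: The shift map on $S^{\mathbb{Z}}$ is $\sigma(x)_i = x_{i+1}$. A subshift is a closed $X \subset S^{\mathbb{Z}}$ with $\sigma(X) = X$ ($S$ a finite alphabet, product topology). An automorphism of $X$ is a homeomorphism $f : X \to X$ with $f \circ \sigma = \sigma \circ f$; automorphisms form a group under composition. Here $0 \in \mathbb{N}$. Let $\square \notin S$. For a word $u$, $|u|$ is its length, words are $0$-indexed, $|u|_{\square}$ is the number of occurrences of $\square$ in $u$, and $u^{\mathbb{Z}}$ is the point with $(u^{\mathbb{Z}})_i = u_{i \bmod |u|}$. For $y, z \in (S \cup \{\square\})^{\mathbb{Z}}$, where $\square$ occurs infinitely often in both tails of $y$, let $\phi(y,z)$ be the point obtained by writing $z$ in order into the $\square$-coordinates of $y$: if $\ell \geq 0$ is the least nonnegative coordinate with $y_\ell = \square$, then $\phi(y,z)_j = y_j$ if $y_j \neq \square$; $\phi(y,z)_\ell = z_0$; $\phi(y,z)_j = z_k$ with $k = |y_{[\ell,j-1]}|_{\square}$ if $y_j = \square$ and $j > \ell$; $\phi(y,z)_j = z_{-k}$ with $k = |y_{[j+1,\ell]}|_{\square}$ if $y_j =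 \square$ and $j < \ell$. For a word $w$ over $S \cup \{\square\}$ with at least one $\square$ and with first and last symbols in $S$, let $x^0(w) = \square^{\mathbb{Z}}$, $x^{i+1}(w) = \phi(x^i(w), w^{\mathbb{Z}})$, and $x(w) = \lim_i x^i(w) \in S^{\mathbb{Z}}$ (the limit exists and contains no $\square$). Then $X_w = \overline{\{\sigma^i(x(w)) \mid i \in \mathbb{Z}\}}$. *)

theory Defs
  imports "HOL-Analysis.Analysis" "HOL-Algebra.Bij" "HOL-Algebra.Elementary_Groups" "HOL-Library.Numeral_Type"
begin

definition full_shift :: "(int \<Rightarrow> 'a) topology" where
  "full_shift = product_topology (\<lambda>_. discrete_topology UNIV) UNIV"

definition shift :: "(int \<Rightarrow> 'a) \<Rightarrow> int \<Rightarrow> 'a" where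
  "shift x = (\<lambda>i. x (i + 1))"

definition subshift :: "(int \<Rightarrow> 'a::finite) set \<Rightarrow> bool" where
  "subshift X \<longleftrightarrow> closedin full_shift X \<and> shift ` X = X"

text \<open>Maps are normalized to be \<^const>\<open>extensional\<close> on \<open>X\<close>, so that two automorphisms are
  equal as HOL functions iff they agree on \<open>X\<close>.\<close>

definition automorphisms :: "(int \<Rightarrow> 'a::finite) set \<Rightarrow> ((int \<Rightarrow> 'a) \<Rightarrow> int \<Rightarrow> 'a) set" where
  "automorphisms X = {f \<in> extensional X.
     homeomorphic_map (subtopology full_shift X) (subtopology full_shift X) f \<and>
     (\<forall>x\<in>X. f (shift x) = shift (f x))}"

definition aut_group :: "(int \<Rightarrow> 'a::finite) set \<Rightarrow> ((int \<Rightarrow> 'a) \<Rightarrow> int \<Rightarrow> 'a) monoid" where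
  "aut_group X = (BijGroup X)\<lparr>carrier := automorphisms X\<rparr>"

text \<open>Partial words and partial points take values in \<^typ>\<open>'a option\<close>; \<^const>\<open>None\<close> is the
  hole symbol.\<close>

definition periodic_point :: "'a list \<Rightarrow> int \<Rightarrow> 'a" where
  "periodic_point u = (\<lambda>i. u ! nat (i mod int (length u)))"

text \<open>The value is meaningful only if the holes of \<open>y\<close> are unbounded in both directions.\<close>

definition fill :: "(int \<Rightarrow> 'a option) \<Rightarrow> (int \<Rightarrow> 'a option) \<Rightarrow> int \<Rightarrow> 'a option" where
  "fill y z = (\<lambda>j. let l = int (LEAST n. y (int n) = None) in
     if y j \<noteq> None then y j
     else if j = l then z 0
     else if j > l then z (int (card {i \<in> {l..j - 1}. y i = None}))
     else z (- int (card {i \<in> {j + 1..l}. y i = None})))"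

fun toeplitz_approx :: "'a option list \<Rightarrow> nat \<Rightarrow> int \<Rightarrow> 'a option" where
  "toeplitz_approx w 0 = (\<lambda>_. None)"
| "toeplitz_approx w (Suc i) = fill (toeplitz_approx w i) (periodic_point w)"

text \<open>The limit is taken over the alphabet with the hole symbol added; \<open>Some \<circ> x\<close> embeds the
  hole-free points.  The limit exists and is hole-free when \<open>w\<close> contains a hole but neither
  begins nor ends with one.\<close>

definition toeplitz_point :: "'a option list \<Rightarrow> int \<Rightarrow> 'a" where
  "toeplitz_point w = (THE x. limitin full_shift (toeplitz_approx w) (Some \<circ> x) sequentially)"

definition toeplitz_subshift :: "'a::finite option list \<Rightarrow> (int \<Rightarrow> 'a) set" where
  "toeplitz_subshift w =
     full_shift closure_of {\<lambda>j. toeplitz_point w (j + i) | i :: int. True}"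

definition rat_group :: "rat monoid" where
  "rat_group = \<lparr>carrier = UNIV, monoid.mult = (+), one = 0\<rparr>"

lemma topspace_full_shift [simp]: "topspace full_shift = UNIV"
  by (simp add: full_shift_def)

lemma homeomorphic_map_shift: "homeomorphic_map full_shift full_shift shift"
proof -
  have "homeomorphic_maps full_shift full_shift (shift :: (int \<Rightarrow> 'a) \<Rightarrow> _) (\<lambda>x i. x (i - 1))"
    unfolding homeomorphic_maps_def full_shift_def
    by (auto simp: shift_def continuous_map_componentwise intro: continuous_map_product_projection)
  then show ?thesis by (rule homeomorphic_maps_imp_map)
qed

lemma subshift_toeplitz_subshift: "subshift (toeplitz_subshift w)"
proof -
  let ?O = "{\<lambda>j. toeplitz_point w (j + i) | i :: int. True}"
  have "shift ` ?O = ?O"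
  proof (intro equalityI subsetI)
    fix y assume "y \<in> shift ` ?O"
    then obtain i where "y = (\<lambda>j. toeplitz_point w (j + (1 + i)))"
      by (auto simp: shift_def add.assoc)
    then show "y \<in> ?O" by blast
  next
    fix y assume "y \<in> ?O"
    then obtain i where "y = (\<lambda>j. toeplitz_point w (j + i))" by blast
    then have "y = shift (\<lambda>j. toeplitz_point w (j + (i - 1)))" by (simp add: shift_def)
    then show "y \<in> shift ` ?O" by blast
  qed
  then have "shift ` toeplitz_subshift w = toeplitz_subshift w"
    using homeomorphic_map_closure_of[OF homeomorphic_map_shift, of ?O]
    by (simp add: toeplitz_subshift_def)
  then show ?thesis by (simp add: subshift_def toeplitz_subshift_def)
qed

lemma group_aut_group:
  fixes X :: "(int \<Rightarrow> 'a::finite) set"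
  assumes "subshift X"
  shows "group (aut_group X)"
proof -
  have shX: "shift ` X = X" using assms by (simp add: subshift_def)
  interpret B: group "BijGroup X" by (rule group_BijGroup)
  let ?T = "subtopology full_shift X :: (int \<Rightarrow> 'a) topology"
  have top: "topspace ?T = X" by simp
  have bij: "f \<in> Bij X" if "f \<in> automorphisms X" for f
    using that homeomorphic_imp_surjective_map[of ?T ?T f] homeomorphic_imp_injective_map[of ?T ?T f]
    by (auto simp: automorphisms_def Bij_def bij_betw_def)
  have sh: "shift x \<in> X" if "x \<in> X" for x using shX that by blast
  have "subgroup (automorphisms X) (BijGroup X)"
  proof (rule B.subgroupI)
    show "automorphisms X \<subseteq> carrier (BijGroup X)" using bij by (auto simp: BijGroup_def)
    have "homeomorphic_map ?T ?T (\<lambda>x\<in>X. x)"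
      by (rule homeomorphic_map_eq[of _ _ id]) (auto simp: top)
    then have "(\<lambda>x\<in>X. x) \<in> automorphisms X" by (auto simp: automorphisms_def sh)
    then show "automorphisms X \<noteq> {}" by blast
  next
    fix f assume f: "f \<in> automorphisms X"
    then have fB: "f \<in> Bij X" by (rule bij)
    then have inv: "inv\<^bsub>BijGroup X\<^esub> f = (\<lambda>x\<in>X. inv_into X f x)" by (rule inv_BijGroup)
    have im: "f ` X = X" "inj_on f X" using fB by (auto simp: Bij_def bij_betw_def)
    from f obtain g where g: "homeomorphic_maps ?T ?T f g"
      by (auto simp: automorphisms_def homeomorphic_map_maps)
    have fg: "g y \<in> X \<and> f (g y) = y" if "y \<in> X" for y
      using g that by (auto simp: homeomorphic_maps_def top continuous_map_def)
    have geq: "inv_into X f y = g y" if "y \<in> X" for y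
      using fg[OF that] im(2) by (metis inv_into_f_f)
    have "homeomorphic_map ?T ?T g"
      using g homeomorphic_maps_map homeomorphic_maps_sym by blast
    then have "homeomorphic_map ?T ?T (\<lambda>x\<in>X. inv_into X f x)"
      by (rule homeomorphic_map_eq) (auto simp: top geq)
    moreover have "g (shift y) = shift (g y)" if "y \<in> X" for y
    proof -
      have "f (shift (g y)) = f (g (shift y))"
        using f fg[OF that] fg[OF sh[OF that]] by (simp add: automorphisms_def)
      then show ?thesis using im(2) fg that sh by (metis inj_onD)
    qed
    ultimately show "inv\<^bsub>BijGroup X\<^esub> f \<in> automorphisms X"
      by (auto simp: inv automorphisms_def geq sh fg)
  next
    fix f g assume fg: "f \<in> automorphisms X" "g \<in> automorphisms X"
    have gX: "g x \<in> X" if "x \<in> X" for x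
      using bij[OF fg(2)] that by (auto simp: Bij_def bij_betw_def)
    have "homeomorphic_map ?T ?T (f \<circ> g)"
      using fg by (auto simp: automorphisms_def intro: homeomorphic_map_compose)
    then have "homeomorphic_map ?T ?T (compose X f g)"
      by (rule homeomorphic_map_eq) (auto simp: top compose_def)
    then have "compose X f g \<in> automorphisms X"
      using fg gX sh by (simp add: automorphisms_def compose_def)
    then show "f \<otimes>\<^bsub>BijGroup X\<^esub> g \<in> automorphisms X"
      using fg bij by (simp add: BijGroup_def)
  qed
  then show ?thesis unfolding aut_group_def by (rule B.subgroup_imp_group)
qed

lemma group_rat_group: "group rat_group"
  by (rule groupI) (auto simp: rat_group_def intro: exI[of _ "- _"] add.left_inverse)

end

theory Submission
  imports Defs
begin

text \<open>
  Let \<open>T y = \<phi>(w\<^sup>\<int>, y)\<close>, so that \<open>x(w)\<close> is the fixed point of \<open>T\<close>, the sets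
  \<open>\<sigma>\<^sup>j T\<^sup>n X\<close> with \<open>0 \<le> j < 5\<^sup>n\<close> partition \<open>X\<close>, and \<open>T \<sigma>\<^sup>2 = \<sigma>\<^sup>5 T\<close>.  An automorphism translates
  each of these partitions; since \<open>x(w)\<close> is the only point of \<open>\<Inter>\<^sub>n T\<^sup>n X\<close> and has a dense orbit, the
  translation amounts determine the automorphism, and automorphisms commute.

  Conjugation by \<open>T\<close> lifts an automorphism \<open>g\<close> of \<open>X\<close> to one acting as \<open>T g T\<^sup>-\<^sup>1\<close> on \<open>T X\<close>, and
  lifting multiplies the translation amount by \<open>5/2\<close>; this realizes all \<open>(5/2)\<^sup>i\<close>.  Conversely every
  automorphism is \<open>\<sigma>\<^sup>k\<close> composed with a lift of some \<open>g\<close>, and since no two holes of \<open>w\<^sup>\<int>\<close> are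
  adjacent, \<open>g\<close> is a block code with a shorter window as long as the window has length at least \<open>2\<close>.
  The descent ends at one-symbol windows, which only admit powers of the shift.
\<close>

section \<open>The substitution and its fixed point\<close>

definition translate :: "int \<Rightarrow> (int \<Rightarrow> 'a) \<Rightarrow> int \<Rightarrow> 'a" where
  "translate i x = (\<lambda>j. x (j + i))"

lemma translate_apply: "translate i x j = x (j + i)"
  by (simp add: translate_def)

lemma translate_0 [simp]: "translate 0 x = x"
  by (simp add: translate_def)

lemma translate_translate [simp]: "translate i (translate j x) = translate (i + j) x"
  by (simp add: translate_def add.assoc)

lemma shift_eq_translate: "shift = translate 1"
  by (simp add: fun_eq_iff shift_def translate_apply)

text \<open>\<^term>\<open>subst u v y\<close> is \<open>\<phi>((u \<box> v \<box> v)\<^sup>\<int>, y)\<close>: the holes lie at \<open>5k + 1\<close> and \<open>5k + 3\<close>, and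
  the hole at \<open>j\<close> is the one with index \<open>2j div 5\<close>; conversely the hole with index \<open>k\<close> lies
  at \<open>(5k + 2) div 2\<close>.\<close>

definition subst :: "'a \<Rightarrow> 'a \<Rightarrow> (int \<Rightarrow> 'a) \<Rightarrow> int \<Rightarrow> 'a" where
  "subst u v y j = (if j mod 5 = 1 \<or> j mod 5 = 3 then y (2 * j div 5)
                    else if j mod 5 = 0 then u else v)"

definition hole :: "int \<Rightarrow> int" where
  "hole k = (5 * k + 2) div 2"

definition unsubst :: "(int \<Rightarrow> 'a) \<Rightarrow> int \<Rightarrow> 'a" where
  "unsubst x k = x (hole k)"

lemma subst_hole [simp]: "subst u v y (hole k) = y k"
proof -
  define q where "q = k div 2"
  have "k = 2 * q \<or> k = 2 * q + 1" unfolding q_def by linarith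
  then have "hole k = 5 * q + 1 \<and> k = 2 * q \<or> hole k = 5 * q + 3 \<and> k = 2 * q + 1"
    unfolding hole_def by linarith
  then have "(hole k mod 5 = 1 \<or> hole k mod 5 = 3) \<and> 2 * hole k div 5 = k" by auto
  then show ?thesis by (simp add: subst_def)
qed

lemma unsubst_subst [simp]: "unsubst (subst u v y) = y"
  by (simp add: fun_eq_iff unsubst_def)

lemma subst_at_hole: "j mod 5 = 1 \<or> j mod 5 = 3 \<Longrightarrow> subst u v y j = y (2 * j div 5)"
  and subst_at_0: "j mod 5 = 0 \<Longrightarrow> subst u v y j = u"
  and subst_at_2_4: "j mod 5 = 2 \<or> j mod 5 = 4 \<Longrightarrow> subst u v y j = v"
  by (auto simp: subst_def)

lemma inj_subst: "subst u v y = subst u v z \<longleftrightarrow> y = z"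
  by (metis unsubst_subst)

lemma subst_cong:
  assumes "j mod 5 = 1 \<or> j mod 5 = 3 \<Longrightarrow> y (2 * j div 5) = z (2 * j div 5)"
  shows "subst u v y j = subst u v z j"
  using assms by (auto simp: subst_def)

lemma subst_translate: "subst u v (translate (2 * k) y) = translate (5 * k) (subst u v y)"
proof
  fix j :: int
  have "2 * (j + 5 * k) = 2 * j + (2 * k) * 5" by simp
  then have "2 * (j + 5 * k) div 5 = 2 * j div 5 + 2 * k" by (simp only: div_mult_self1)
  moreover have "(j + 5 * k) mod 5 = j mod 5" by simp
  ultimately show "subst u v (translate (2 * k) y) j = translate (5 * k) (subst u v y) j"
    by (simp add: subst_def translate_apply)
qed

text \<open>Each application of \<open>subst\<close> trades one factor 2 of the translation for a
  factor 5, so \<open>2 ^ n\<close> is exactly what \<open>n\<close> applications consume.\<close>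

lemma funpow_subst_translate:
  "(subst u v ^^ n) (translate (2 ^ n * k) y) = translate (5 ^ n * k) ((subst u v ^^ n) y)"
proof (induction n arbitrary: k)
  case (Suc n)
  have "(subst u v ^^ n) (translate (2 ^ Suc n * k) y) = translate (2 * (5 ^ n * k)) ((subst u v ^^ n) y)"
    using Suc.IH[of "2 * k"] by (simp only: power_Suc2 mult.assoc mult.left_commute[of 2])
  then show ?case
    by (simp only: funpow.simps comp_apply subst_translate power_Suc mult.assoc)
qed simp

lemma hole_cases:
  fixes j :: int
  assumes "j mod 5 = 1 \<or> j mod 5 = 3"
  obtains q where "j = 5 * q + 1" "2 * j div 5 = 2 * q"
    | q where "j = 5 * q + 3" "2 * j div 5 = 2 * q + 1"
proof -
  define q where "q = j div 5"
  have "j = 5 * q + j mod 5" by (simp add: q_def)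
  with assms have "j = 5 * q + 1 \<or> j = 5 * q + 3" by auto
  then show ?thesis
  proof
    assume "j = 5 * q + 1"
    then show ?thesis by (intro that(1)[of q]) simp_all
  next
    assume "j = 5 * q + 3"
    then show ?thesis by (intro that(2)[of q]) simp_all
  qed
qed

text \<open>Position 0 is never a hole, and elsewhere reading through a hole moves strictly towards
  the origin. This contraction makes the iterates of \<open>subst\<close> converge.\<close>

lemma hole_index_less:
  fixes j :: int
  assumes "j mod 5 = 1 \<or> j mod 5 = 3"
  shows "\<bar>2 * j div 5\<bar> < \<bar>j\<bar>"
  by (rule hole_cases[OF assms]) linarith+

text \<open>Each step either meets a constant symbol or moves closer to 0, where the symbol is
  constant; within \<open>n\<close> steps the seed is out of reach.\<close>

lemma funpow_subst_local: "\<bar>j\<bar> < int n \<Longrightarrow> (subst u v ^^ n) y j = (subst u v ^^ n) z j"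
proof (induction n arbitrary: j)
  case (Suc n)
  have "(subst u v ^^ n) y (2 * j div 5) = (subst u v ^^ n) z (2 * j div 5)"
    if "j mod 5 = 1 \<or> j mod 5 = 3"
    using Suc.IH[of "2 * j div 5"] hole_index_less[OF that] Suc.prems by simp
  then show ?case unfolding funpow.simps comp_apply by (rule subst_cong)
qed simp

section \<open>The fixed point of the substitution\<close>

abbreviation T :: "(int \<Rightarrow> 2) \<Rightarrow> int \<Rightarrow> 2" where
  "T \<equiv> subst 1 0"

text \<open>The limit of the iterates of \<open>T\<close>, given pointwise: by
  \<open>funpow_subst_local\<close>, coordinate \<open>j\<close> is settled after |j| + 1
  applications.\<close>

definition xs :: "int \<Rightarrow> 2" where
  "xs j = (T ^^ Suc (nat \<bar>j\<bar>)) (\<lambda>_. 0) j"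

lemma funpow_T_eq_xs:
  assumes "\<bar>j\<bar> < int n"
  shows "(T ^^ n) y j = xs j"
proof -
  define m where "m = Suc (nat \<bar>j\<bar>)"
  have "n = m + (n - m)" using assms by (simp add: m_def)
  then have "(T ^^ n) y j = (T ^^ m) ((T ^^ (n - m)) y) j" by (metis comp_apply funpow_add)
  also have "\<dots> = xs j" unfolding xs_def m_def by (rule funpow_subst_local) simp
  finally show ?thesis .
qed

lemma T_xs [simp]: "T xs = xs"
proof
  fix j
  define n where "n = Suc (nat \<bar>j\<bar>)"
  have "xs j = T ((T ^^ n) xs) j"
    using funpow_T_eq_xs[of j "Suc n" xs] by (simp add: n_def)
  also have "\<dots> = T xs j"
    using hole_index_less[of j] by (intro subst_cong funpow_T_eq_xs) (auto simp: n_def)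
  finally show "T xs j = xs j" by simp
qed

lemma funpow_T_xs [simp]: "(T ^^ n) xs = xs"
  by (induction n) auto

lemma xs_rec: "xs j = (if j mod 5 = 1 \<or> j mod 5 = 3 then xs (2 * j div 5) else if j mod 5 = 0 then 1 else 0)"
  using fun_cong[OF T_xs, of j] unfolding subst_def by simp

lemma xs_values [simp]: "xs 0 = 1" "xs 1 = 1" "xs 2 = 0" "xs 3 = 1" "xs 4 = 0" "xs 6 = 0"
  proof -
  show 0: "xs 0 = 1" by (subst xs_rec) simp
  show 1: "xs 1 = 1" by (subst xs_rec) (simp add: 0)
  show 2: "xs 2 = 0" by (subst xs_rec) simp
  show "xs 3 = 1" by (subst xs_rec) (simp add: 1)
  show "xs 4 = 0" by (subst xs_rec) simp
  show "xs 6 = 0" by (subst xs_rec) (simp add: 2)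
qed

lemma eq_xs_if_in_all_ranges:
  assumes "\<And>n. x \<in> range (T ^^ n)"
  shows "x = xs"
proof
  fix j
  obtain y where "x = (T ^^ Suc (nat \<bar>j\<bar>)) y" using assms[of "Suc (nat \<bar>j\<bar>)"] by (elim rangeE)
  moreover have "\<bar>j\<bar> < int (Suc (nat \<bar>j\<bar>))" by simp
  ultimately show "x j = xs j" by (simp only: funpow_T_eq_xs)
qed

text \<open>Symmetric cylinder neighbourhoods of the product topology. For negative \<open>m\<close>
  the relation is vacuous, so proofs that need a nonnegative radius pass to |m|.\<close>

definition agree :: "int \<Rightarrow> (int \<Rightarrow> 'a) \<Rightarrow> (int \<Rightarrow> 'a) \<Rightarrow> bool" where
  "agree m x y \<longleftrightarrow> (\<forall>j. \<bar>j\<bar> \<le> m \<longrightarrow> x j = y j)"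

lemma agreeD: "agree m x y \<Longrightarrow> \<bar>j\<bar> \<le> m \<Longrightarrow> x j = y j"
  by (simp add: agree_def)

lemma agree_refl [simp]: "agree m x x"
  by (simp add: agree_def)

lemma agree_sym: "agree m x y \<Longrightarrow> agree m y x"
  by (simp add: agree_def)

lemma agree_trans: "agree m x y \<Longrightarrow> agree m y z \<Longrightarrow> agree m x z"
  by (simp add: agree_def)

lemma agree_mono: "agree m x y \<Longrightarrow> n \<le> m \<Longrightarrow> agree n x y"
  by (simp add: agree_def)

lemma agree_translate:
  assumes "agree (m + \<bar>i\<bar>) x y"
  shows "agree m (translate i x) (translate i y)"
  unfolding agree_def translate_apply by (intro allI impI agreeD[OF assms]) linarith

lemma agree_subst:
  assumes "agree m y z"
  shows "agree m (subst u v y) (subst u v z)"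
  unfolding agree_def
proof (intro allI impI, rule subst_cong)
  fix j :: int
  assume "\<bar>j\<bar> \<le> m" "j mod 5 = 1 \<or> j mod 5 = 3"
  then show "y (2 * j div 5) = z (2 * j div 5)"
    using hole_index_less[of j] agreeD[OF assms, of "2 * j div 5"] by simp
qed

lemma agree_unsubst:
  assumes "agree (5 * m + 1) x y" "0 \<le> m"
  shows "agree m (unsubst x) (unsubst y)"
  unfolding agree_def unsubst_def
proof (intro allI impI agreeD[OF assms(1)])
  fix j :: int
  assume "\<bar>j\<bar> \<le> m"
  then show "\<bar>hole j\<bar> \<le> 5 * m + 1" unfolding hole_def by linarith
qed

text \<open>Recognizability: \<open>T z\<close> is \<open>1\<close> on the residue \<open>0\<close> modulo \<open>5\<close> and \<open>0\<close> on the residues \<open>2\<close> and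
  \<open>4\<close>, whatever \<open>z\<close> is; comparing these three residues excludes every nonzero offset.\<close>

lemma recognizable_step:
  assumes "\<And>i. i \<in> {0, 2, 4} \<Longrightarrow> T y i = T z (i + j)"
  shows "5 dvd j"
proof -
  have "T y 0 = T z j" "T y 2 = T z (2 + j)" "T y 4 = T z (4 + j)"
    using assms[of 0] assms[of 2] assms[of 4] by auto
  then have *: "T z j = 1" "T z (2 + j) = 0" "T z (4 + j) = 0"
    by (auto simp: subst_def)
  have "j mod 5 = 0 \<or> j mod 5 = 1 \<or> j mod 5 = 2 \<or> j mod 5 = 3 \<or> j mod 5 = 4" by presburger
  moreover have "j mod 5 \<noteq> 1"
  proof
    assume "j mod 5 = 1"
    then have "(4 + j) mod 5 = 0" by presburger
    then show False using *(3) by (simp add: subst_def)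
  qed
  moreover have "j mod 5 \<noteq> 3"
  proof
    assume "j mod 5 = 3"
    then have "(2 + j) mod 5 = 0" by presburger
    then show False using *(2) by (simp add: subst_def)
  qed
  ultimately have "j mod 5 = 0" using *(1) by (auto simp: subst_def)
  then show ?thesis by presburger
qed

text \<open>\<open>recognizable_step\<close> gives the first factor 5. Desubstituting turns the
  offset \<open>5 * k\<close> into \<open>2 * k\<close>, and the factor 2 cancels because it is
  prime to 5. The radius depends on \<open>n\<close> only.\<close>

lemma recognizable:
  "\<exists>M\<ge>0. \<forall>y z j. agree M ((T ^^ n) y) (translate j ((T ^^ n) z)) \<longrightarrow> 5 ^ n dvd j"
proof (induction n)
  case (Suc n)
  then obtain M where M: "M \<ge> 0"
    "\<And>y z j. agree M ((T ^^ n) y) (translate j ((T ^^ n) z)) \<Longrightarrow> 5 ^ n dvd j" by blast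
  have "5 ^ Suc n dvd j"
    if a: "agree (5 * M + 5) ((T ^^ Suc n) y) (translate j ((T ^^ Suc n) z))" for y z j
  proof -
    have "5 dvd j"
      using a M(1) by (intro recognizable_step[of "(T ^^ n) y" "(T ^^ n) z"]) (auto simp: agree_def translate_apply)
    then obtain k where k: "j = 5 * k" by blast
    have "agree M (unsubst ((T ^^ Suc n) y)) (unsubst (translate j ((T ^^ Suc n) z)))"
      by (rule agree_unsubst[OF agree_mono[OF a]]) (use M(1) in auto)
    then have "agree M ((T ^^ n) y) (translate (2 * k) ((T ^^ n) z))"
      by (simp add: k flip: subst_translate)
    then have "5 ^ n dvd 2 * k" by (rule M(2))
    moreover have "coprime (5 ^ n) (2 :: int)" by simp
    ultimately have "5 ^ n dvd k" using coprime_dvd_mult_right_iff by blast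
    then show ?thesis by (simp add: k)
  qed
  moreover have "0 \<le> 5 * M + 5" using M(1) by simp
  ultimately show ?case by blast
qed auto

text \<open>\<open>unsubst\<close> is a continuous left inverse of \<open>T\<close>, so
  approximations of \<open>x\<close> in the range desubstitute to approximations of
  \<open>unsubst x\<close>.\<close>

lemma closed_range_funpow_T:
  assumes "\<And>m. \<exists>y \<in> range (T ^^ n). agree m x y"
  shows "x \<in> range (T ^^ n)"
  using assms
proof (induction n arbitrary: x)
  case (Suc n)
  have "\<exists>y \<in> range (T ^^ n). agree m (unsubst x) y" for m
  proof -
    obtain z where z: "agree (5 * \<bar>m\<bar> + 1) x ((T ^^ Suc n) z)" using Suc.prems by blast
    have "agree \<bar>m\<bar> (unsubst x) ((T ^^ n) z)"
      using agree_unsubst[OF z] by simp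
    then have "agree m (unsubst x) ((T ^^ n) z)" by (rule agree_mono) simp
    then show ?thesis by blast
  qed
  then obtain z where z: "unsubst x = (T ^^ n) z" using Suc.IH by blast
  have "x j = T (unsubst x) j" for j
  proof -
    obtain y where y: "agree (5 * \<bar>j\<bar> + 1) x ((T ^^ Suc n) y)" using Suc.prems by blast
    have "agree \<bar>j\<bar> (unsubst x) ((T ^^ n) y)" using agree_unsubst[OF y] by simp
    then have "agree \<bar>j\<bar> (T (unsubst x)) ((T ^^ Suc n) y)" using agree_subst by force
    then show ?thesis using y by (simp add: agree_def)
  qed
  then show ?case using z by (auto simp: fun_eq_iff intro!: exI[of _ z])
qed simp

section \<open>The subshift and its odometer cells\<close>

definition orbit_closure :: "(int \<Rightarrow> 2) set" where
  "orbit_closure = {x. \<forall>m. \<exists>i. agree m x (translate i xs)}"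

abbreviation X :: "(int \<Rightarrow> 2) set" where
  "X \<equiv> orbit_closure"

lemma xs_in_X [simp]: "xs \<in> X"
  unfolding orbit_closure_def by (auto intro!: exI[of _ 0])

lemma translate_in_X [simp]:
  assumes "x \<in> X"
  shows "translate k x \<in> X"
  unfolding orbit_closure_def
proof safe
  fix m
  obtain i where "agree (m + \<bar>k\<bar>) x (translate i xs)"
    using assms unfolding orbit_closure_def by blast
  then have "agree m (translate k x) (translate (k + i) xs)"
    by (drule_tac agree_translate) simp
  then show "\<exists>i. agree m (translate k x) (translate i xs)" by blast
qed

text \<open>The Toeplitz property: translating \<open>xs = (T ^^ n) xs\<close> by a multiple of
  \<open>5 ^ n\<close> gives another image under \<open>T ^^ n\<close>, and all such images agree
  near 0.\<close>

lemma xs_periodic: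
  assumes "\<bar>j\<bar> < int n"
  shows "xs (j + 5 ^ n * k) = xs j"
proof -
  have "xs (j + 5 ^ n * k) = translate (5 ^ n * k) ((T ^^ n) xs) j"
    by (simp add: translate_apply)
  also have "\<dots> = (T ^^ n) (translate (2 ^ n * k) xs) j"
    by (simp only: funpow_subst_translate)
  finally show ?thesis using assms by (simp only: funpow_T_eq_xs)
qed

text \<open>Only even translations pass through \<open>T\<close>. An odd one is corrected by adding
  the odd number \<open>5 ^ n\<close>, a period of \<open>xs\<close> on the coordinates in
  view.\<close>

lemma approx_by_even_translate:
  assumes "x \<in> X"
  obtains k where "agree m x (translate (2 * k) xs)"
proof -
  obtain i where i: "agree \<bar>m\<bar> x (translate i xs)"
    using assms unfolding orbit_closure_def by blast
  show ?thesis
  proof (cases "even i")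
    case True
    then obtain k where k: "i = 2 * k" by blast
    show ?thesis by (rule that[of k], rule agree_mono[OF i[unfolded k]]) simp
  next
    case False
    define n where "n = Suc (nat (\<bar>m\<bar> + \<bar>i\<bar>))"
    have "agree \<bar>m\<bar> (translate i xs) (translate (i + 5 ^ n) xs)"
      unfolding agree_def
    proof (intro allI impI)
      fix j :: int
      assume "\<bar>j\<bar> \<le> \<bar>m\<bar>"
      then have "\<bar>j + i\<bar> < int n" by (simp add: n_def)
      from xs_periodic[OF this, of 1] show "translate i xs j = translate (i + 5 ^ n) xs j"
        by (simp add: translate_apply add.assoc)
    qed
    then have "agree m x (translate (i + 5 ^ n) xs)"
      by (rule agree_mono[OF agree_trans[OF i]]) simp
    moreover obtain k where "i + 5 ^ n = 2 * k"
      using False by (metis (no_types) dvd_def even_add even_numeral even_power odd_numeral)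
    ultimately show ?thesis using that by simp
  qed
qed

lemma T_in_X:
  assumes "x \<in> X"
  shows "T x \<in> X"
  unfolding orbit_closure_def
proof safe
  fix m
  obtain k where "agree m x (translate (2 * k) xs)" using approx_by_even_translate[OF assms] .
  then have "agree m (T x) (translate (5 * k) xs)"
    using agree_subst[of m x "translate (2 * k) xs" 1 0] by (simp only: subst_translate T_xs)
  then show "\<exists>i. agree m (T x) (translate i xs)" by blast
qed

lemma T_in_X_iff [simp]: "T x \<in> X \<longleftrightarrow> x \<in> X"
proof
  assume x: "T x \<in> X"
  show "x \<in> X"
    unfolding orbit_closure_def
  proof safe
    fix m
    obtain i where i: "agree (5 * \<bar>m\<bar> + 5) (T x) (translate i (T xs))"
      using x unfolding orbit_closure_def T_xs by blast
    have "5 dvd i"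
      by (rule recognizable_step[of x xs]) (use i in \<open>auto simp: agree_def translate_apply\<close>)
    then obtain k where "i = 5 * k" by blast
    then have "agree (5 * \<bar>m\<bar> + 1) (T x) (T (translate (2 * k) xs))"
      using agree_mono[OF i] by (simp add: subst_translate)
    then have "agree \<bar>m\<bar> x (translate (2 * k) xs)"
      by (drule_tac agree_unsubst) simp_all
    then have "agree m x (translate (2 * k) xs)" by (rule agree_mono) simp
    then show "\<exists>i. agree m x (translate i xs)" by blast
  qed
qed (rule T_in_X)

text \<open>This is sigma^j T^n X, a cylinder of the 5-adic odometer. The index \<open>j\<close> is
  any integer and matters modulo \<open>5 ^ n\<close>, by \<open>cell_cong\<close> and
  \<open>cell_unique\<close>.\<close>

definition cell :: "nat \<Rightarrow> int \<Rightarrow> (int \<Rightarrow> 2) set" where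
  "cell n j = {x \<in> X. translate (- j) x \<in> range (T ^^ n)}"

lemma cellI: "x \<in> X \<Longrightarrow> translate (- j) x = (T ^^ n) y \<Longrightarrow> x \<in> cell n j"
  by (simp add: cell_def)

lemma cellE:
  assumes "x \<in> cell n j"
  obtains y where "x \<in> X" "translate (- j) x = (T ^^ n) y"
  using assms by (auto simp: cell_def)

lemma cell_imp_X: "x \<in> cell n j \<Longrightarrow> x \<in> X"
  by (simp add: cell_def)

lemma xs_in_cell: "xs \<in> cell n 0"
  by (rule cellI[of _ _ _ xs]) simp_all

lemma translate_in_cell: "x \<in> cell n i \<Longrightarrow> translate k x \<in> cell n (i + k)"
  by (simp add: cell_def)

lemma cell_cong:
  assumes "5 ^ n dvd i - j" "x \<in> cell n i"
  shows "x \<in> cell n j"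
proof -
  obtain k where k: "i - j = 5 ^ n * k" using assms(1) by blast
  obtain y where y: "x \<in> X" "translate (- i) x = (T ^^ n) y" using assms(2) by (rule cellE)
  have "translate (- j) x = translate (i - j) (translate (- i) x)" by simp
  also have "\<dots> = (T ^^ n) (translate (2 ^ n * k) y)"
    by (simp only: k y(2) funpow_subst_translate)
  finally show ?thesis using y(1) by (intro cellI)
qed

lemma cell_unique:
  assumes "x \<in> cell n i" "x \<in> cell n j"
  shows "5 ^ n dvd i - j"
proof -
  obtain y z where y: "translate (- i) x = (T ^^ n) y" and z: "translate (- j) x = (T ^^ n) z"
    using assms by (elim cellE)
  obtain M where M: "\<And>y z k. agree M ((T ^^ n) y) (translate k ((T ^^ n) z)) \<Longrightarrow> 5 ^ n dvd k"
    using recognizable by blast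
  have "translate (i - j) ((T ^^ n) y) = (T ^^ n) z"
    unfolding y[symmetric] z[symmetric] by simp
  then show ?thesis using M[of z "i - j" y] by simp
qed

lemma approx_in_cell:
  assumes "x \<in> cell n j"
  obtains i where "5 ^ n dvd i - j" "agree m x (translate i xs)"
proof -
  obtain M where M: "\<And>y z k. agree M ((T ^^ n) y) (translate k ((T ^^ n) z)) \<Longrightarrow> 5 ^ n dvd k"
    using recognizable by blast
  obtain y where y: "x \<in> X" "translate (- j) x = (T ^^ n) y" using assms by (rule cellE)
  obtain i where i: "agree (\<bar>m\<bar> + \<bar>M\<bar> + \<bar>- j\<bar>) x (translate i xs)"
    using y(1) unfolding orbit_closure_def by blast
  have "agree (\<bar>m\<bar> + \<bar>M\<bar>) ((T ^^ n) y) (translate (i - j) ((T ^^ n) xs))"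
    using agree_translate[OF i] by (simp add: y(2))
  then have "agree M ((T ^^ n) y) (translate (i - j) ((T ^^ n) xs))" by (rule agree_mono) simp
  then have "5 ^ n dvd i - j" by (rule M)
  moreover have "agree m x (translate i xs)" using i by (rule agree_mono) simp
  ultimately show ?thesis by (rule that)
qed

text \<open>By recognizability, all sufficiently good approximations of \<open>x\<close> by translates of \<open>xs\<close> use
  translations in the same class modulo \<open>5\<^sup>n\<close>.\<close>

lemma cell_exists:
  assumes "x \<in> X"
  obtains j where "x \<in> cell n j"
proof -
  obtain M where M: "\<And>y z k. agree M ((T ^^ n) y) (translate k ((T ^^ n) z)) \<Longrightarrow> 5 ^ n dvd k"
    using recognizable by blast
  have ex: "\<exists>i. agree m x (translate i xs)" for m
    using assms unfolding orbit_closure_def by blast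
  obtain i where i: "agree (\<bar>M\<bar> + 5 ^ n) x (translate i xs)" using ex by blast
  \<comment> \<open>One coarse approximation fixes the class: splitting \<open>i\<close> by
    \<open>5 ^ n\<close> writes \<open>translate i xs\<close> as
    \<open>translate j ((T ^^ n) z)\<close>. Keeping \<open>j\<close> below \<open>5 ^ n\<close>
    bounds the cost of recentring.\<close>
  define j where "j = i mod 5 ^ n"
  define z where "z = translate (2 ^ n * (i div 5 ^ n)) xs"
  have j: "0 \<le> j" "j < 5 ^ n" by (simp_all add: j_def)
  have "translate i xs = translate j (translate (5 ^ n * (i div 5 ^ n)) ((T ^^ n) xs))"
    by (simp add: j_def)
  then have iz: "translate i xs = translate j ((T ^^ n) z)"
    by (simp only: z_def funpow_subst_translate)
  have "translate (- j) x \<in> range (T ^^ n)"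
  proof (rule closed_range_funpow_T)
    fix m
    obtain k where k: "agree (\<bar>m\<bar> + \<bar>M\<bar> + 5 ^ n) x (translate k xs)" using ex by blast
    have "agree (\<bar>M\<bar> + 5 ^ n) (translate j ((T ^^ n) z)) (translate k xs)"
      by (rule agree_trans[OF agree_sym[OF i[unfolded iz]] agree_mono[OF k]]) simp
    then have "agree (M + \<bar>- j\<bar>) (translate j ((T ^^ n) z)) (translate k ((T ^^ n) xs))"
      unfolding funpow_T_xs by (rule agree_mono) (use j in simp)
    then have "agree M ((T ^^ n) z) (translate (k - j) ((T ^^ n) xs))"
      by (drule_tac agree_translate) simp
    then have "5 ^ n dvd k - j" by (rule M)
    then obtain l where l: "k - j = 5 ^ n * l" by blast
    have "agree (m + \<bar>- j\<bar>) x (translate k xs)"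
      using k by (rule agree_mono) (use j in simp)
    then have "agree m (translate (- j) x) (translate (k - j) ((T ^^ n) xs))"
      by (drule_tac agree_translate) simp
    then have "agree m (translate (- j) x) ((T ^^ n) (translate (2 ^ n * l) xs))"
      by (simp only: l funpow_subst_translate)
    then show "\<exists>y \<in> range (T ^^ n). agree m (translate (- j) x) y" by blast
  qed
  then show ?thesis using assms that by (auto simp: cell_def)
qed
section \<open>Block codes\<close>

text \<open>Block codes on \<open>X\<close>. A uniform radius at coordinate 0 replaces continuity;
  the two are linked by \<open>endo_if_continuous\<close> and
  \<open>continuous_if_endo\<close>.\<close>

definition endo :: "((int \<Rightarrow> 2) \<Rightarrow> int \<Rightarrow> 2) \<Rightarrow> bool" where
  "endo f \<longleftrightarrow> (\<forall>x\<in>X. f x \<in> X) \<and> (\<forall>x\<in>X. f (translate 1 x) = translate 1 (f x)) \<and>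
     (\<exists>r. \<forall>x\<in>X. \<forall>y\<in>X. agree r x y \<longrightarrow> f x 0 = f y 0)"

lemma endo_in_X: "endo f \<Longrightarrow> x \<in> X \<Longrightarrow> f x \<in> X"
  by (simp add: endo_def)

lemma endo_cong:
  assumes "endo f" "\<And>x. x \<in> X \<Longrightarrow> g x = f x"
  shows "endo g"
proof -
  obtain r where "\<forall>x\<in>X. \<forall>y\<in>X. agree r x y \<longrightarrow> f x 0 = f y 0"
    using assms(1) unfolding endo_def by blast
  then have "\<forall>x\<in>X. \<forall>y\<in>X. agree r x y \<longrightarrow> g x 0 = g y 0"
    using assms(2) by fastforce
  moreover have "\<forall>x\<in>X. g x \<in> X" "\<forall>x\<in>X. g (translate 1 x) = translate 1 (g x)"
    using assms unfolding endo_def by simp_all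
  ultimately show ?thesis unfolding endo_def by blast
qed

lemma endo_translate_commute:
  assumes "endo f" "x \<in> X"
  shows "f (translate k x) = translate k (f x)"
proof -
  have 1: "f (translate 1 y) = translate 1 (f y)" if "y \<in> X" for y
    using assms(1) that by (simp add: endo_def)
  show ?thesis
  proof (induction k rule: int_induct[where k = 0])
    case (step1 i)
    then show ?case using 1[of "translate i x"] assms(2) by (simp add: add.commute)
  next
    case (step2 i)
    have "translate i (f x) = translate 1 (f (translate (i - 1) x))"
      using 1[of "translate (i - 1) x"] assms(2) step2 by simp
    from arg_cong[OF this, of "translate (- 1)"] show ?case by simp
  qed simp
qed

lemma endo_agree:
  assumes "endo f"
  obtains M where "M \<ge> 0" "\<And>x y. x \<in> X \<Longrightarrow> y \<in> X \<Longrightarrow> agree M x y \<Longrightarrow> agree m (f x) (f y)"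
proof -
  obtain r where r: "\<And>x y. x \<in> X \<Longrightarrow> y \<in> X \<Longrightarrow> agree r x y \<Longrightarrow> f x 0 = f y 0"
    using assms unfolding endo_def by blast
  show ?thesis
  proof (rule that[of "\<bar>m\<bar> + \<bar>r\<bar>"])
    fix x y
    assume xy: "x \<in> X" "y \<in> X" "agree (\<bar>m\<bar> + \<bar>r\<bar>) x y"
    show "agree m (f x) (f y)"
      unfolding agree_def
    proof (intro allI impI)
      fix j :: int
      assume "\<bar>j\<bar> \<le> m"
      then have "agree (r + \<bar>j\<bar>) x y" by (intro agree_mono[OF xy(3)]) simp
      then have "agree r (translate j x) (translate j y)" by (rule agree_translate)
      then have "f (translate j x) 0 = f (translate j y) 0" using xy by (intro r) simp_all
      then show "f x j = f y j"
        using xy assms by (simp add: endo_translate_commute) (simp add: translate_apply)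
    qed
  qed simp
qed

lemma endo_comp:
  assumes "endo f" "endo g"
  shows "endo (\<lambda>x. f (g x))"
proof -
  obtain r where r: "\<And>x y. x \<in> X \<Longrightarrow> y \<in> X \<Longrightarrow> agree r x y \<Longrightarrow> f x 0 = f y 0"
    using assms(1) unfolding endo_def by blast
  obtain M where "\<And>x y. x \<in> X \<Longrightarrow> y \<in> X \<Longrightarrow> agree M x y \<Longrightarrow> agree r (g x) (g y)"
    using endo_agree[OF assms(2)] by metis
  then have "\<forall>x\<in>X. \<forall>y\<in>X. agree M x y \<longrightarrow> f (g x) 0 = f (g y) 0"
    using r endo_in_X[OF assms(2)] by blast
  then show ?thesis
    unfolding endo_def[of "\<lambda>x. f (g x)"]
  proof (intro conjI exI)
    show "\<forall>x\<in>X. \<forall>y\<in>X. agree M x y \<longrightarrow> f (g x) 0 = f (g y) 0" by fact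
  qed (use assms in \<open>simp_all add: endo_in_X endo_translate_commute\<close>)
qed

lemma endo_translate: "endo (translate k)"
  unfolding endo_def
proof (intro conjI exI[of _ "\<bar>k\<bar>"])
  show "\<forall>x\<in>X. \<forall>y\<in>X. agree \<bar>k\<bar> x y \<longrightarrow> translate k x 0 = translate k y 0"
    by (simp add: agree_def translate_apply)
qed (simp_all add: add.commute)

text \<open>Approximate \<open>x\<close> by translates of \<open>xs\<close> along the class of
  \<open>i\<close>; there \<open>f\<close> is known by commutation, and closedness of
  \<open>range (T ^^ n)\<close> allows passing to the limit.\<close>

lemma endo_cell:
  assumes f: "endo f" "f xs \<in> cell n j" and x: "x \<in> cell n i"
  shows "f x \<in> cell n (i + j)"
proof -
  have xX: "x \<in> X" using x by (rule cell_imp_X)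
  obtain z where z: "translate (- j) (f xs) = (T ^^ n) z" using f(2) by (rule cellE)
  have "translate (- (i + j)) (f x) \<in> range (T ^^ n)"
  proof (rule closed_range_funpow_T)
    fix m
    obtain M where M: "\<And>x y. x \<in> X \<Longrightarrow> y \<in> X \<Longrightarrow> agree M x y \<Longrightarrow> agree (m + \<bar>- (i + j)\<bar>) (f x) (f y)"
      using endo_agree[OF f(1)] by metis
    obtain k where k: "5 ^ n dvd k - i" "agree M x (translate k xs)" by (rule approx_in_cell[OF x])
    obtain l where l: "k - i = 5 ^ n * l" using k(1) by blast
    have "agree (m + \<bar>- (i + j)\<bar>) (f x) (f (translate k xs))" by (rule M[OF xX _ k(2)]) simp
    then have "agree m (translate (- (i + j)) (f x)) (translate (- (i + j)) (f (translate k xs)))"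
      by (rule agree_translate)
    also have "translate (- (i + j)) (f (translate k xs)) = translate (k - i) (translate (- j) (f xs))"
      by (simp add: endo_translate_commute[OF f(1)] algebra_simps)
    also have "\<dots> = (T ^^ n) (translate (2 ^ n * l) z)"
      by (simp only: z l funpow_subst_translate)
    finally show "\<exists>y \<in> range (T ^^ n). agree m (translate (- (i + j)) (f x)) y" by blast
  qed
  then show ?thesis using endo_in_X[OF f(1) xX] by (simp add: cell_def)
qed

text \<open>Lying in every zero cell puts \<open>f xs\<close> in every
  \<open>range (T ^^ n)\<close>, so \<open>f xs = xs\<close>; the rest follows from density of the
  orbit of \<open>xs\<close>.\<close>

lemma endo_eq_id:
  assumes f: "endo f" "\<And>n. f xs \<in> cell n 0" and x: "x \<in> X"
  shows "f x = x"
proof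
  fix k
  have "f xs \<in> range (T ^^ n)" for n using f(2)[of n] by (simp add: cell_def)
  then have xs: "f xs = xs" by (rule eq_xs_if_in_all_ranges)
  obtain M where M: "\<And>x y. x \<in> X \<Longrightarrow> y \<in> X \<Longrightarrow> agree M x y \<Longrightarrow> agree \<bar>k\<bar> (f x) (f y)"
    using endo_agree[OF f(1)] by metis
  obtain i where i: "agree (\<bar>k\<bar> + \<bar>M\<bar>) x (translate i xs)"
    using x unfolding orbit_closure_def by blast
  have "agree M x (translate i xs)" using i by (rule agree_mono) simp
  then have "agree \<bar>k\<bar> (f x) (f (translate i xs))" using x by (intro M) simp_all
  then have "f x k = translate i xs k"
    by (simp add: endo_translate_commute[OF f(1)] xs agree_def)
  also have "\<dots> = x k" using i by (simp add: agree_def)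
  finally show "f x k = x k" .
qed

text \<open>Automorphisms as block codes, with the inverse kept as a witness so that lifting and
  desubstitution can act on both.\<close>

definition inv_pair :: "((int \<Rightarrow> 2) \<Rightarrow> int \<Rightarrow> 2) \<Rightarrow> ((int \<Rightarrow> 2) \<Rightarrow> int \<Rightarrow> 2) \<Rightarrow> bool" where
  "inv_pair f g \<longleftrightarrow> endo f \<and> endo g \<and> (\<forall>x\<in>X. f (g x) = x \<and> g (f x) = x)"

lemma inv_pair_sym: "inv_pair f g \<Longrightarrow> inv_pair g f"
  by (auto simp: inv_pair_def)

lemma inv_pair_comp:
  assumes "inv_pair f f'" "inv_pair g g'"
  shows "inv_pair (\<lambda>x. f (g x)) (\<lambda>x. g' (f' x))"
  using assms by (auto simp: inv_pair_def endo_comp endo_in_X)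

lemma inv_pair_translate: "inv_pair (translate k) (translate (- k))"
  by (simp add: inv_pair_def endo_translate)

lemma inverse_cell:
  assumes "inv_pair f g" "f xs \<in> cell n j"
  shows "g xs \<in> cell n (- j)"
proof -
  have e: "endo f" "endo g" "g (f xs) = xs" using assms(1) by (simp_all add: inv_pair_def)
  obtain i where i: "g xs \<in> cell n i" by (rule cell_exists[OF endo_in_X[OF e(2) xs_in_X]])
  have "xs \<in> cell n (j + i)" using endo_cell[OF e(2) i assms(2)] e(3) by simp
  then have "5 ^ n dvd (j + i) - 0" using xs_in_cell by (rule cell_unique)
  then show ?thesis using i by (intro cell_cong[OF _ i]) (simp add: add.commute)
qed

text \<open>\<open>f'\<close> undoes the translation of the cells by \<open>f\<close>, so the
  composite \<open>f' (g x)\<close> falls under \<open>endo_eq_id\<close>.\<close>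

lemma endo_determined_by_cells:
  assumes f: "inv_pair f f'" and g: "endo g"
    and c: "\<And>n. \<exists>j. f xs \<in> cell n j \<and> g xs \<in> cell n j" and x: "x \<in> X"
  shows "g x = f x"
proof -
  have f': "endo f'" using f by (simp add: inv_pair_def)
  have "f' (g xs) \<in> cell n 0" for n
  proof -
    obtain j where "f xs \<in> cell n j" "g xs \<in> cell n j" using c by blast
    from endo_cell[OF f' inverse_cell[OF f this(1)] this(2)] show ?thesis by simp
  qed
  then have "f' (g x) = x" using endo_eq_id[OF endo_comp[OF f' g]] x by blast
  then have "f (f' (g x)) = f x" by simp
  then show ?thesis using f x endo_in_X[OF g] by (simp add: inv_pair_def)
qed

text \<open>Cell classes add under composition, and addition commutes; so both composites move
  \<open>xs\<close> to the same cells.\<close>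

lemma inv_pair_commute:
  assumes f: "inv_pair f f'" and g: "inv_pair g g'" and x: "x \<in> X"
  shows "f (g x) = g (f x)"
proof (rule sym, rule endo_determined_by_cells[OF inv_pair_comp[OF f g] _ _ x])
  have e: "endo f" "endo g" using f g by (simp_all add: inv_pair_def)
  show "endo (\<lambda>x. g (f x))" by (rule endo_comp[OF e(2,1)])
  fix n
  obtain i where i: "f xs \<in> cell n i" by (rule cell_exists[OF endo_in_X[OF e(1) xs_in_X]])
  obtain j where j: "g xs \<in> cell n j" by (rule cell_exists[OF endo_in_X[OF e(2) xs_in_X]])
  show "\<exists>j. f (g xs) \<in> cell n j \<and> g (f xs) \<in> cell n j"
    using endo_cell[OF e(1) i j] endo_cell[OF e(2) j i] by (auto simp: add.commute)
qed

section \<open>Lifting through the substitution\<close>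

lemma X_eq_translate_T:
  assumes "x \<in> X"
  obtains k y where "0 \<le> k" "k < 5" "y \<in> X" "x = translate k (T y)"
proof -
  obtain j where j: "x \<in> cell 1 j" by (rule cell_exists[OF assms])
  define k where "k = j mod 5"
  have "x \<in> cell 1 k" by (rule cell_cong[OF _ j]) (simp add: k_def minus_mod_eq_mult_div)
  then obtain y where y: "translate (- k) x = T y" by (auto elim: cellE)
  then have "T y \<in> X" using assms translate_in_X by metis
  moreover have "x = translate k (T y)" by (simp flip: y)
  ultimately show ?thesis using that[of k y] by (simp add: k_def)
qed

text \<open>The conjugate of \<open>f\<close> by \<open>T\<close> on \<open>T X\<close>, extended
  along the orbits. The chosen offset is unique only modulo 5.\<close>

definition lift :: "((int \<Rightarrow> 2) \<Rightarrow> int \<Rightarrow> 2) \<Rightarrow> (int \<Rightarrow> 2) \<Rightarrow> int \<Rightarrow> 2" where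
  "lift f x = (let k = SOME k. x \<in> cell 1 k
     in translate k (T (f (unsubst (translate (- k) x)))))"

text \<open>Changing the offset by \<open>5 * l\<close> changes the desubstituted point by the
  translation \<open>2 * l\<close>, with which \<open>f\<close> commutes.\<close>

lemma lift_eq:
  assumes "endo f" "y \<in> X"
  shows "lift f (translate k (T y)) = translate k (T (f y))"
proof -
  define x where "x = translate k (T y)"
  have k: "x \<in> cell 1 k" using assms(2) by (intro cellI[of _ _ _ y]) (simp_all add: x_def)
  define i where "i = (SOME k. x \<in> cell 1 k)"
  have "x \<in> cell 1 i" unfolding i_def using k by (rule someI)
  then obtain l where l: "k - i = 5 * l" using cell_unique[OF k] by fastforce
  have "translate (- i) x = translate (k - i) (T y)" by (simp add: x_def)
  then have "translate (- i) x = T (translate (2 * l) y)"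
    by (simp only: l subst_translate)
  then have "lift f x = translate i (T (f (translate (2 * l) y)))"
    unfolding lift_def Let_def i_def[symmetric] by simp
  also have "\<dots> = translate (i + 5 * l) (T (f y))"
    by (simp add: endo_translate_commute[OF assms] subst_translate)
  finally show ?thesis using l by (simp add: x_def algebra_simps)
qed

lemma endo_lift:
  assumes "endo f"
  shows "endo (lift f)"
proof -
  obtain M where M: "M \<ge> 0" "\<And>x y. x \<in> X \<Longrightarrow> y \<in> X \<Longrightarrow> agree M x y \<Longrightarrow> agree 5 (f x) (f y)"
    using endo_agree[OF assms] by metis
  have "lift f x \<in> X \<and> lift f (translate 1 x) = translate 1 (lift f x)" if x: "x \<in> X" for x
  proof -
    obtain k y where y: "y \<in> X" "x = translate k (T y)" by (rule X_eq_translate_T[OF x])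
    then show ?thesis using lift_eq[OF assms y(1)] endo_in_X[OF assms y(1)] by simp
  qed
  \<comment> \<open>The radius \<open>5 * M + 10\<close> leaves room for offsets below 5 on top of
    \<open>5 * M + 1\<close>, and covers the test coordinates of
    \<open>recognizable_step\<close>.\<close>
  moreover have "lift f x 0 = lift f x' 0"
    if x: "x \<in> X" "x' \<in> X" and a: "agree (5 * M + 10) x x'" for x x'
  proof -
    obtain k y where y: "0 \<le> k" "k < 5" "y \<in> X" "x = translate k (T y)"
      by (rule X_eq_translate_T[OF x(1)])
    obtain k' y' where y': "0 \<le> k'" "k' < 5" "y' \<in> X" "x' = translate k' (T y')"
      by (rule X_eq_translate_T[OF x(2)])
    have "agree ((5 * M + 1) + \<bar>- k\<bar>) x x'" by (rule agree_mono[OF a]) (use y in simp)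
    then have t: "agree (5 * M + 1) (T y) (translate (k' - k) (T y'))"
      unfolding y(4) y'(4) by (drule_tac agree_translate) simp
    have "5 dvd k' - k"
    proof (rule recognizable_step)
      fix i :: int
      assume "i \<in> {0, 2, 4}"
      moreover have "x (i - k) = x' (i - k)"
        by (rule agreeD[OF a]) (use y \<open>i \<in> _\<close> M(1) in auto)
      ultimately show "T y i = T y' (i + (k' - k))"
        by (simp add: y(4) y'(4) translate_apply algebra_simps)
    qed
    then have k: "k' = k" using y(1,2) y'(1,2) by presburger
    have "agree M y y'" using agree_unsubst[OF t M(1)] by (simp add: k)
    then have "agree 5 (T (f y)) (T (f y'))" using y y' by (intro agree_subst M)
    then have "T (f y) k = T (f y') k" using y by (simp add: agree_def)
    then show ?thesis
      using lift_eq[OF assms y(3), of k] lift_eq[OF assms y'(3), of k']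
      by (simp add: k y(4) y'(4)) (simp add: translate_apply)
  qed
  ultimately show ?thesis unfolding endo_def by blast
qed

lemma inv_pair_lift:
  assumes "inv_pair f g"
  shows "inv_pair (lift f) (lift g)"
proof -
  have e: "endo f" "endo g" using assms by (simp_all add: inv_pair_def)
  have "lift f (lift g x) = x \<and> lift g (lift f x) = x" if "x \<in> X" for x
  proof -
    obtain k y where y: "y \<in> X" "x = translate k (T y)" by (rule X_eq_translate_T[OF \<open>x \<in> X\<close>])
    then show ?thesis using assms e by (simp add: lift_eq endo_in_X inv_pair_def)
  qed
  then show ?thesis using e by (simp add: inv_pair_def endo_lift)
qed

text \<open>The reverse conjugation, meaningful when \<open>f\<close> preserves \<open>T X\<close>,
  that is, when \<open>f xs \<in> cell 1 0\<close>.\<close>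

definition desubst :: "((int \<Rightarrow> 2) \<Rightarrow> int \<Rightarrow> 2) \<Rightarrow> (int \<Rightarrow> 2) \<Rightarrow> int \<Rightarrow> 2" where
  "desubst f y = unsubst (f (T y))"

lemma T_desubst:
  assumes "endo f" "f xs \<in> cell 1 0" "y \<in> X"
  shows "T (desubst f y) = f (T y)" "desubst f y \<in> X"
proof -
  have "T y \<in> cell 1 0" using assms(3) by (intro cellI[of _ _ _ y]) simp_all
  from endo_cell[OF assms(1,2) this] have "f (T y) \<in> cell 1 0" by simp
  then obtain z where z: "f (T y) \<in> X" "f (T y) = T z" by (auto elim: cellE)
  then show "T (desubst f y) = f (T y)" "desubst f y \<in> X"
    by (simp_all add: desubst_def)
qed

text \<open>As \<open>T \<sigma>\<^sup>2 = \<sigma>\<^sup>5 T\<close>, only commutation with \<open>\<sigma>\<^sup>2\<close> is immediate.  Commutation with \<open>\<sigma>\<close> itself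
  amounts to \<open>f\<close> commuting with the lift of \<open>\<sigma>\<close>, a square root of \<open>\<sigma>\<^sup>5\<close>.\<close>

lemma endo_desubst:
  assumes f: "inv_pair f f'" and c: "f xs \<in> cell 1 0"
  shows "endo (desubst f)"
proof -
  have e: "endo f" using f by (simp add: inv_pair_def)
  note t = T_desubst[OF e c]
  have "desubst f (translate 1 y) = translate 1 (desubst f y)" if y: "y \<in> X" for y
  proof -
    let ?r = "lift (translate 1)"
    have r: "?r (T z) = T (translate 1 z)" if "z \<in> X" for z
      using lift_eq[OF endo_translate that, of 1 0] by simp
    have "T (desubst f (translate 1 y)) = f (?r (T y))"
      using y by (simp add: t(1) r)
    also have "\<dots> = ?r (f (T y))"
      using y by (intro inv_pair_commute[OF f inv_pair_lift[OF inv_pair_translate]]) simp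
    also have "\<dots> = T (translate 1 (desubst f y))"
      using y t(2) by (simp add: r flip: t(1))
    finally show ?thesis by (simp only: inj_subst)
  qed
  \<comment> \<open>\<open>desubst f\<close> reads \<open>f (T x)\<close> at
    \<open>hole 0 = 1\<close>, hence radius 1.\<close>
  moreover obtain M where M: "M \<ge> 0"
    "\<And>x y. x \<in> X \<Longrightarrow> y \<in> X \<Longrightarrow> agree M x y \<Longrightarrow> agree 1 (f x) (f y)"
    using endo_agree[OF e] by metis
  have "desubst f x 0 = desubst f y 0" if "x \<in> X" "y \<in> X" "agree M x y" for x y
  proof -
    have "agree 1 (f (T x)) (f (T y))" using that by (intro M(2) agree_subst) simp_all
    then show ?thesis by (simp add: desubst_def unsubst_def hole_def agree_def)
  qed
  ultimately show ?thesis unfolding endo_def using t(2) by blast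
qed

lemma inv_pair_desubst:
  assumes f: "inv_pair f f'" and c: "f xs \<in> cell 1 0"
  shows "inv_pair (desubst f) (desubst f')"
proof -
  have c': "f' xs \<in> cell 1 0" using inverse_cell[OF f c] by simp
  have e: "endo f" "endo f'" using f by (simp_all add: inv_pair_def)
  note t = T_desubst[OF e(1) c] T_desubst[OF e(2) c']
  have "T (desubst f (desubst f' x)) = T x" "T (desubst f' (desubst f x)) = T x" if "x \<in> X" for x
    using that f t by (simp_all add: inv_pair_def)
  then show ?thesis
    using endo_desubst[OF f c] endo_desubst[OF inv_pair_sym[OF f] c']
    by (simp add: inv_pair_def inj_subst)
qed

section \<open>Rotation numbers\<close>

text \<open>\<open>rotation f q\<close> says that \<open>f\<close> acts on the \<open>5\<close>-adic odometer as translation by the dyadic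
  rational \<open>q\<close>, which is a \<open>5\<close>-adic integer.\<close>

definition rotation :: "((int \<Rightarrow> 2) \<Rightarrow> int \<Rightarrow> 2) \<Rightarrow> rat \<Rightarrow> bool" where
  "rotation f q \<longleftrightarrow> (\<exists>m a. q = of_int a / 2 ^ m \<and>
     (\<forall>n. \<exists>j. 5 ^ n dvd 2 ^ m * j - a \<and> f xs \<in> cell n j))"

lemma rotationI:
  assumes "q = of_int a / 2 ^ m" "\<And>n. \<exists>j. 5 ^ n dvd 2 ^ m * j - a \<and> f xs \<in> cell n j"
  shows "rotation f q"
  using assms unfolding rotation_def by blast

lemma rotationE:
  assumes "rotation f q"
  obtains m a where "q = of_int a / 2 ^ m" "\<And>n. \<exists>j. 5 ^ n dvd 2 ^ m * j - a \<and> f xs \<in> cell n j"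
  using assms unfolding rotation_def by blast

lemma rotation_cong:
  assumes "rotation f q" "g xs = f xs"
  shows "rotation g q"
  using assms by (simp add: rotation_def)

lemma rotation_translate:
  assumes "f xs = translate a xs"
  shows "rotation f (of_int a)"
proof (rule rotationI[of _ a 0])
  fix n
  have "f xs \<in> cell n a" using translate_in_cell[OF xs_in_cell[of n], of a] by (simp add: assms)
  then show "\<exists>j. 5 ^ n dvd 2 ^ 0 * j - a \<and> f xs \<in> cell n j" by (intro exI[of _ a]) simp
qed simp

lemma dyadic_eq_iff:
  "(of_int a / 2 ^ m :: rat) = of_int b / 2 ^ k \<longleftrightarrow> a * 2 ^ k = b * 2 ^ m"
proof -
  have "(of_int a / 2 ^ m :: rat) = of_int b / 2 ^ k \<longleftrightarrow> (of_int (a * 2 ^ k) :: rat) = of_int (b * 2 ^ m)"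
    by (simp add: frac_eq_eq)
  then show ?thesis by (simp only: of_int_eq_iff)
qed

text \<open>The cross-multiplied difference \<open>d\<close> of two candidates vanishes modulo every
  power of 5, hence is 0.\<close>

lemma rotation_unique:
  assumes "rotation f q" "rotation f r"
  shows "q = r"
proof -
  obtain m a where a: "q = of_int a / 2 ^ m" "\<And>n. \<exists>j. 5 ^ n dvd 2 ^ m * j - a \<and> f xs \<in> cell n j"
    using assms(1) by (rule rotationE) blast
  obtain k b where b: "r = of_int b / 2 ^ k" "\<And>n. \<exists>j. 5 ^ n dvd 2 ^ k * j - b \<and> f xs \<in> cell n j"
    using assms(2) by (rule rotationE) blast
  define d where "d = a * 2 ^ k - b * 2 ^ m"
  have "5 ^ n dvd d" for n
  proof -
    obtain i where i: "5 ^ n dvd 2 ^ m * i - a" "f xs \<in> cell n i" using a(2) by blast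
    obtain j where j: "5 ^ n dvd 2 ^ k * j - b" "f xs \<in> cell n j" using b(2) by blast
    have "d = 2 ^ m * (2 ^ k * j - b) - 2 ^ k * (2 ^ m * i - a) + 2 ^ (m + k) * (i - j)"
      by (simp add: d_def power_add algebra_simps)
    then show ?thesis using i(1) j(1) cell_unique[OF i(2) j(2)] by (metis dvd_add dvd_diff dvd_mult)
  qed
  \<comment> \<open>The exponent |d| is chosen so that the power of 5 exceeds |d|.\<close>
  then have dv: "5 ^ nat \<bar>d\<bar> dvd d" .
  have "d = 0"
  proof (rule ccontr)
    assume "d \<noteq> 0"
    then have "(5 :: int) ^ nat \<bar>d\<bar> \<le> \<bar>d\<bar>" using dvd_imp_le_int[OF _ dv] by simp
    moreover have "int (nat \<bar>d\<bar>) < int (5 ^ nat \<bar>d\<bar>)"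
      by (subst of_nat_less_iff) (rule power_gt_expt, simp)
    ultimately show False by simp
  qed
  then show ?thesis unfolding a(1) b(1) dyadic_eq_iff by (simp add: d_def)
qed

text \<open>As 2 is invertible modulo \<open>5 ^ n\<close>, the number determines the class at each
  level.\<close>

lemma rotation_same_cells:
  assumes "rotation f q" "rotation g q"
  shows "\<exists>j. f xs \<in> cell n j \<and> g xs \<in> cell n j"
proof -
  obtain m a where a: "q = of_int a / 2 ^ m" "\<And>n. \<exists>j. 5 ^ n dvd 2 ^ m * j - a \<and> f xs \<in> cell n j"
    using assms(1) by (rule rotationE) blast
  obtain k b where b: "q = of_int b / 2 ^ k" "\<And>n. \<exists>j. 5 ^ n dvd 2 ^ k * j - b \<and> g xs \<in> cell n j"
    using assms(2) by (rule rotationE) blast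
  have ab: "a * 2 ^ k = b * 2 ^ m" using a(1) b(1) dyadic_eq_iff by metis
  obtain i where i: "5 ^ n dvd 2 ^ m * i - a" "f xs \<in> cell n i" using a(2) by blast
  obtain j where j: "5 ^ n dvd 2 ^ k * j - b" "g xs \<in> cell n j" using b(2) by blast
  have "2 ^ (m + k) * (j - i) = 2 ^ m * (2 ^ k * j - b) - 2 ^ k * (2 ^ m * i - a)"
    using ab by (simp add: power_add algebra_simps)
  then have "5 ^ n dvd 2 ^ (m + k) * (j - i)" using i(1) j(1) by (metis dvd_diff dvd_mult)
  moreover have "coprime (5 ^ n) (2 ^ (m + k) :: int)" by simp
  ultimately have "5 ^ n dvd j - i" using coprime_dvd_mult_right_iff by blast
  then have "g xs \<in> cell n i" using j(2) by (rule cell_cong)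
  then show ?thesis using i(2) by blast
qed

lemma rotation_comp:
  assumes "endo f" "rotation f q" "rotation g r"
  shows "rotation (\<lambda>x. f (g x)) (q + r)"
proof -
  obtain m a where a: "q = of_int a / 2 ^ m" "\<And>n. \<exists>j. 5 ^ n dvd 2 ^ m * j - a \<and> f xs \<in> cell n j"
    using assms(2) by (rule rotationE) blast
  obtain k b where b: "r = of_int b / 2 ^ k" "\<And>n. \<exists>j. 5 ^ n dvd 2 ^ k * j - b \<and> g xs \<in> cell n j"
    using assms(3) by (rule rotationE) blast
  show ?thesis
  proof (rule rotationI[of _ "a * 2 ^ k + b * 2 ^ m" "m + k"])
    show "q + r = of_int (a * 2 ^ k + b * 2 ^ m) / 2 ^ (m + k)"
      by (simp add: a(1) b(1) power_add field_simps)
    fix n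
    obtain i where i: "5 ^ n dvd 2 ^ m * i - a" "f xs \<in> cell n i" using a(2) by blast
    obtain j where j: "5 ^ n dvd 2 ^ k * j - b" "g xs \<in> cell n j" using b(2) by blast
    have "2 ^ (m + k) * (j + i) - (a * 2 ^ k + b * 2 ^ m) =
        2 ^ m * (2 ^ k * j - b) + 2 ^ k * (2 ^ m * i - a)"
      by (simp add: power_add algebra_simps)
    then have "5 ^ n dvd 2 ^ (m + k) * (j + i) - (a * 2 ^ k + b * 2 ^ m)"
      using i(1) j(1) by (metis dvd_add dvd_mult)
    then show "\<exists>j. 5 ^ n dvd 2 ^ (m + k) * j - (a * 2 ^ k + b * 2 ^ m) \<and> f (g xs) \<in> cell n j"
      using endo_cell[OF assms(1) i(2) j(2)] by blast
  qed
qed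

lemma rotation_inverse:
  assumes "inv_pair f g" "rotation f q"
  shows "rotation g (- q)"
proof -
  obtain m a where a: "q = of_int a / 2 ^ m" "\<And>n. \<exists>j. 5 ^ n dvd 2 ^ m * j - a \<and> f xs \<in> cell n j"
    using assms(2) by (rule rotationE) blast
  show ?thesis
  proof (rule rotationI[of _ "- a" m])
    fix n
    obtain j where j: "5 ^ n dvd 2 ^ m * j - a" "f xs \<in> cell n j" using a(2) by blast
    have "2 ^ m * (- j) - (- a) = - (2 ^ m * j - a)" by simp
    then have "5 ^ n dvd 2 ^ m * (- j) - (- a)" using j(1) by (simp only: dvd_minus_iff)
    then show "\<exists>j. 5 ^ n dvd 2 ^ m * j - - a \<and> g xs \<in> cell n j"
      using inverse_cell[OF assms(1) j(2)] by blast
  qed (simp add: a(1))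
qed

lemma T_in_cell:
  assumes "x \<in> cell n (2 * i)"
  shows "T x \<in> cell (Suc n) (5 * i)"
proof -
  obtain y where y: "x \<in> X" "translate (- (2 * i)) x = (T ^^ n) y" using assms by (rule cellE)
  have "translate (- (5 * i)) (T x) = T (translate (- (2 * i)) x)"
    using subst_translate[of 1 0 "- i" x] by simp
  then show ?thesis using y by (intro cellI[of _ _ _ y]) simp_all
qed

text \<open>\<open>T\<close> raises the level by one and carries the class \<open>2 * i\<close> to
  \<open>5 * i\<close>; this is the source of the factor 5/2.\<close>

lemma rotation_T:
  assumes "rotation g q" "f xs = T (g xs)"
  shows "rotation f (5 / 2 * q)"
proof -
  obtain m a where a: "q = of_int a / 2 ^ m" "\<And>n. \<exists>j. 5 ^ n dvd 2 ^ m * j - a \<and> g xs \<in> cell n j"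
    using assms(1) by (rule rotationE) blast
  show ?thesis
  proof (rule rotationI[of _ "5 * a" "Suc m"])
    show "5 / 2 * q = of_int (5 * a) / 2 ^ Suc m" by (simp add: a(1))
    fix n
    show "\<exists>j. 5 ^ n dvd 2 ^ Suc m * j - 5 * a \<and> f xs \<in> cell n j"
    proof (cases n)
      case 0
      obtain j where "g xs \<in> cell 0 j" using a(2) by blast
      then have "f xs \<in> cell 0 j" by (simp add: cell_def assms(2))
      then show ?thesis using 0 by auto
    next
      case (Suc k)
      obtain j where j: "5 ^ k dvd 2 ^ m * j - a" "g xs \<in> cell k j" using a(2) by blast
      \<comment> \<open>\<open>T_in_cell\<close> needs an even representative; the odd modulus
        \<open>5 ^ k\<close> makes one available.\<close>
      obtain i where i: "5 ^ k dvd j - 2 * i"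
      proof (cases "even j")
        case True
        then obtain i where "j = 2 * i" by (elim evenE)
        then show ?thesis using that[of i] by simp
      next
        case False
        then have "even (j + 5 ^ k)" by simp
        then obtain i where "j + 5 ^ k = 2 * i" by (elim evenE)
        then have "j - 2 * i = - (5 ^ k)" by simp
        then show ?thesis using that[of i] by simp
      qed
      have "f xs \<in> cell n (5 * i)"
        unfolding Suc assms(2) by (rule T_in_cell[OF cell_cong[OF i j(2)]])
      moreover have "2 ^ m * (2 * i) - a = (2 ^ m * j - a) - 2 ^ m * (j - 2 * i)"
        by (simp add: algebra_simps)
      then have "5 ^ k dvd 2 ^ m * (2 * i) - a" using i j(1) by (metis dvd_diff dvd_mult)
      then have "5 * 5 ^ k dvd 5 * (2 ^ m * (2 * i) - a)" by (rule mult_dvd_mono[OF dvd_refl])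
      then have "5 ^ n dvd 2 ^ Suc m * (5 * i) - 5 * a"
        by (simp add: Suc algebra_simps)
      ultimately show ?thesis by blast
    qed
  qed
qed

section \<open>Every automorphism has a rotation number\<close>

abbreviation "G \<equiv> generate rat_group {(5 / 2) ^ i | i :: nat. True}"

lemma rat_group_simps [simp]:
  "carrier rat_group = UNIV" "x \<otimes>\<^bsub>rat_group\<^esub> y = x + y" "\<one>\<^bsub>rat_group\<^esub> = 0"
  by (simp_all add: rat_group_def)

lemma inv_rat_group [simp]: "inv\<^bsub>rat_group\<^esub> x = - x"
  by (rule group.inv_equality[OF group_rat_group]) simp_all

lemma power_in_G: "(5 / 2) ^ i \<in> G"
  by (rule generate.incl) blast

lemma add_in_G: "x \<in> G \<Longrightarrow> y \<in> G \<Longrightarrow> x + y \<in> G"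
  using generate.eng[of x rat_group _ y] by simp

lemma minus_power_in_G: "- ((5 / 2) ^ i) \<in> G"
  using generate.inv[of "(5 / 2) ^ i" "{(5 / 2) ^ i | i :: nat. True}" rat_group] by auto

lemma of_int_in_G: "of_int a \<in> G"
proof (induction a rule: int_induct[where k = 0])
  case base
  show ?case using generate.one[of rat_group] by simp
next
  case (step1 i)
  then show ?case using add_in_G power_in_G[of 0] by simp
next
  case (step2 i)
  then show ?case using add_in_G[OF _ minus_power_in_G[of 0]] by simp
qed

lemma mult_in_G:
  assumes "x \<in> G"
  shows "5 / 2 * x \<in> G"
  using assms
proof induction
  case one
  show ?case using generate.one[of rat_group] by simp
next
  case (incl h)
  then obtain i :: nat where "h = (5 / 2) ^ i" by blast
  then show ?case using power_in_G[of "Suc i"] by simp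
next
  case (inv h)
  then obtain i :: nat where "h = (5 / 2) ^ i" by blast
  then show ?case using minus_power_in_G[of "Suc i"] by simp
next
  case (eng x y)
  then show ?case using add_in_G by (simp add: ring_distribs)
qed

text \<open>The interval may start anywhere, because the descent tracks its length only. Length 0
  stands for constant codes.\<close>

definition window :: "((int \<Rightarrow> 2) \<Rightarrow> int \<Rightarrow> 2) \<Rightarrow> int \<Rightarrow> nat \<Rightarrow> bool" where
  "window f a l \<longleftrightarrow> (\<forall>x\<in>X. \<forall>y\<in>X. (\<forall>i. a \<le> i \<and> i < a + int l \<longrightarrow> x i = y i) \<longrightarrow> f x 0 = f y 0)"

lemma windowD:
  assumes "window f a l" "x \<in> X" "y \<in> X" "\<And>i. a \<le> i \<Longrightarrow> i < a + int l \<Longrightarrow> x i = y i"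
  shows "f x 0 = f y 0"
  using assms unfolding window_def by blast

lemma endo_window:
  assumes "endo f"
  obtains a l where "window f a l"
proof -
  obtain r where r: "\<And>x y. x \<in> X \<Longrightarrow> y \<in> X \<Longrightarrow> agree r x y \<Longrightarrow> f x 0 = f y 0"
    using assms unfolding endo_def by blast
  have "window f (- r) (nat (2 * r + 1))"
    unfolding window_def
  proof (intro ballI impI r)
    fix x y :: "int \<Rightarrow> 2"
    assume "\<forall>i. - r \<le> i \<and> i < - r + int (nat (2 * r + 1)) \<longrightarrow> x i = y i"
    then show "agree r x y" unfolding agree_def by (simp add: abs_le_iff)
  qed
  then show ?thesis by (rule that)
qed

lemma window_translate:
  assumes "endo f" "window f a l"
  shows "window (\<lambda>x. translate k (f x)) (a + k) l"
  unfolding window_def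
proof (intro ballI impI)
  fix x y
  assume xy: "x \<in> X" "y \<in> X" "\<forall>i. a + k \<le> i \<and> i < a + k + int l \<longrightarrow> x i = y i"
  have "f (translate k x) 0 = f (translate k y) 0"
    by (rule windowD[OF assms(2)]) (use xy in \<open>simp_all add: translate_apply\<close>)
  then show "translate k (f x) 0 = translate k (f y) 0"
    using xy by (simp add: endo_translate_commute[OF assms(1)])
qed

text \<open>No two holes are adjacent, so a window of length \<open>l \<ge> 2\<close> sees fewer than \<open>l\<close> holes.\<close>

lemma window_desubst:
  assumes f: "endo f" and w: "window f a l" and l: "l \<ge> 2"
  shows "window (desubst f) ((2 * a + 4) div 5) (l - 1)"
  unfolding window_def
proof (intro ballI impI)
  \<comment> \<open>\<open>b\<close> is 2a/5 rounded up, the index of the first hole at or after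
    position \<open>a + 1\<close>. Reading starts there because coordinate 0 of
    \<open>desubst f x\<close> is \<open>f (T x)\<close> at \<open>hole 0 = 1\<close>.\<close>
  define b where "b = (2 * a + 4) div 5"
  have b: "5 * b \<le> 2 * a + 4" "2 * a + 4 < 5 * b + 5" unfolding b_def by linarith+
  fix x y
  assume xy: "x \<in> X" "y \<in> X"
    and "\<forall>i. (2 * a + 4) div 5 \<le> i \<and> i < (2 * a + 4) div 5 + int (l - 1) \<longrightarrow> x i = y i"
  then have eq: "x i = y i" if "b \<le> i" "i < b + int l - 1" for i
    using that l by (simp add: b_def)
  have "f (translate 1 (T x)) 0 = f (translate 1 (T y)) 0"
  proof (rule windowD[OF w])
    fix i
    assume i: "a \<le> i" "i < a + int l"
    have "T x (i + 1) = T y (i + 1)"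
    proof (rule subst_cong, rule eq)
      assume h: "(i + 1) mod 5 = 1 \<or> (i + 1) mod 5 = 3"
      then show "b \<le> 2 * (i + 1) div 5" "2 * (i + 1) div 5 < b + int l - 1"
        by (rule hole_cases; use i b l in linarith)+
    qed
    then show "translate 1 (T x) i = translate 1 (T y) i" by (simp add: translate_apply)
  qed (use xy in simp_all)
  then have "translate 1 (f (T x)) 0 = translate 1 (f (T y)) 0"
    using xy by (simp add: endo_translate_commute[OF f])
  then show "desubst f x 0 = desubst f y 0"
    by (simp add: desubst_def unsubst_def hole_def translate_apply)
qed

text \<open>A point of \<open>X\<close> has the constant symbol \<open>0\<close> along two classes modulo \<open>5\<close> but the constant
  symbol \<open>1\<close> along only one, so a one-symbol block code can neither be constant nor exchange the
  two symbols.\<close>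

lemma rotation_if_window_le_1:
  assumes f: "endo f" and w: "window f a l" and l: "l \<le> 1"
  shows "rotation f (of_int a)"
proof (rule rotation_translate)
  have loc: "f xs i = f xs j" if "xs (i + a) = xs (j + a)" for i j
  proof -
    have "f (translate i xs) 0 = f (translate j xs) 0"
    proof (rule windowD[OF w])
      fix k
      assume "a \<le> k" "k < a + int l"
      then have "k = a" using l by simp
      then show "translate i xs k = translate j xs k" using that by (simp add: translate_apply add.commute)
    qed simp_all
    then show ?thesis by (simp add: endo_translate_commute[OF f]) (simp add: translate_apply)
  qed
  obtain k y where y: "f xs = translate k (T y)"
    by (rule X_eq_translate_T[OF endo_in_X[OF f xs_in_X]])
  \<comment> \<open>Alignment of the two points: the image of the symbol \<open>xs j\<close> stands
    at \<open>T y (j + c)\<close>. As \<open>xs 0 = 1\<close> and \<open>xs 2 = 0\<close>, the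
    images of 1 and 0 are \<open>u\<close> and \<open>v\<close>.\<close>
  define c where "c = k - a"
  define u where "u = f xs (- a)"
  define v where "v = f xs (2 - a)"
  have two: "z = 0 \<or> z = 1" for z :: 2 using exhaust_2[of z] by auto
  have eval: "f xs i = (if xs (i + a) = 1 then u else v)" for i
    using loc[of i "- a"] loc[of i "2 - a"] two[of "xs (i + a)"] by (auto simp: u_def v_def)
  have F: "T y (j + c) = (if xs j = 1 then u else v)" for j
    using eval[of "j - a"] by (simp add: y c_def translate_apply algebra_simps)
  have "u \<noteq> v"
  proof
    assume "u = v"
    then have "T y j = u" for j using F[of "j - c"] by simp
    then have "T y 0 = T y 2" by simp
    then show False by (simp add: subst_def)
  qed
  moreover have "\<not> (u = 0 \<and> v = 1)"
  proof
    assume "u = 0 \<and> v = 1"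
    \<comment> \<open>\<open>xs\<close> has symbol 1 at 0, 1 and symbol 0 at 2, 4, 6; after an
      exchange each of these five places excludes one residue of \<open>c\<close> modulo 5.\<close>
    then have F': "T y c = 0" "T y (1 + c) = 0" "T y (2 + c) = 1" "T y (4 + c) = 1" "T y (6 + c) = 1"
      using F[of 0] F[of 1] F[of 2] F[of 4] F[of 6] by simp_all
    have "c mod 5 \<noteq> 0" using F'(1) by (auto simp: subst_at_0)
    moreover have "(1 + c) mod 5 \<noteq> 0" using F'(2) by (auto simp: subst_at_0)
    moreover have "(2 + c) mod 5 \<noteq> 4" using F'(3) by (auto simp: subst_at_2_4)
    moreover have "(4 + c) mod 5 \<noteq> 2" using F'(4) by (auto simp: subst_at_2_4)
    moreover have "(6 + c) mod 5 \<noteq> 2" using F'(5) by (auto simp: subst_at_2_4)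
    ultimately show False by presburger
  qed
  ultimately have "u = 1" "v = 0" using two[of u] two[of v] by auto
  then show "f xs = translate a xs"
    using eval two by (auto simp: fun_eq_iff translate_apply)
qed

text \<open>Descent on the window length: a translation moves \<open>f xs\<close> into the zero cell
  of level 1, desubstitution shortens the window by 1, and the number \<open>q\<close> found there
  returns as \<open>k + 5/2 * q\<close>.\<close>

lemma ex_rotation_window:
  assumes "inv_pair f f'" "window f a l"
  shows "\<exists>q \<in> G. rotation f q"
  using assms
proof (induction l arbitrary: f f' a rule: less_induct)
  case (less l)
  have f: "endo f" using less.prems(1) by (simp add: inv_pair_def)
  show ?case
  proof (cases "l \<le> 1")
    case True
    then show ?thesis using rotation_if_window_le_1[OF f less.prems(2)] of_int_in_G by blast
  next
    case False
    obtain k where k: "f xs \<in> cell 1 k" by (rule cell_exists[OF endo_in_X[OF f xs_in_X]])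
    define g where "g = (\<lambda>x. translate (- k) (f x))"
    define g' where "g' = (\<lambda>x. f' (translate k x))"
    have g: "inv_pair g g'"
      using inv_pair_comp[OF inv_pair_translate[of "- k"] less.prems(1)] by (simp add: g_def g'_def)
    then have eg: "endo g" by (simp add: inv_pair_def)
    have c: "g xs \<in> cell 1 0" using translate_in_cell[OF k, of "- k"] by (simp add: g_def)
    have "window g (a + - k) l"
      using window_translate[OF f less.prems(2), of "- k"] by (simp add: g_def)
    then have "window (desubst g) ((2 * (a + - k) + 4) div 5) (l - 1)"
      using False by (intro window_desubst[OF eg]) simp_all
    then obtain q where q: "q \<in> G" "rotation (desubst g) q"
      using less.IH[OF _ inv_pair_desubst[OF g c], of "l - 1"] False by auto
    have "g xs = T (desubst g xs)" using T_desubst(1)[OF eg c xs_in_X] by simp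
    with q(2) have "rotation g (5 / 2 * q)" by (rule rotation_T)
    then have "rotation (\<lambda>x. translate k (g x)) (of_int k + 5 / 2 * q)"
      by (intro rotation_comp endo_translate rotation_translate refl)
    then have "rotation f (of_int k + 5 / 2 * q)" by (rule rotation_cong) (simp add: g_def)
    then show ?thesis using add_in_G[OF of_int_in_G mult_in_G[OF q(1)]] by blast
  qed
qed

lemma ex_rotation: "inv_pair f f' \<Longrightarrow> \<exists>q \<in> G. rotation f q"
  using ex_rotation_window endo_window by (metis inv_pair_def)

text \<open>Lift the shift \<open>i\<close> times: since \<open>T xs = xs\<close>,
  \<open>lift f xs\<close> equals \<open>T (f xs)\<close>, so each lift multiplies the number by
  5/2.\<close>

lemma ex_inv_pair_rotation_power: "\<exists>f g. inv_pair f g \<and> rotation f ((5 / 2) ^ i)"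
proof (induction i)
  case 0
  have "rotation (translate 1) (of_int 1)" by (rule rotation_translate) (rule refl)
  then show ?case using inv_pair_translate[of 1] by auto
next
  case (Suc i)
  then obtain f g where fg: "inv_pair f g" "rotation f ((5 / 2) ^ i)" by blast
  then have "lift f xs = T (f xs)" using lift_eq[of f xs 0] by (simp add: inv_pair_def)
  then have "rotation (lift f) ((5 / 2) ^ Suc i)"
    using rotation_T[OF fg(2), of "lift f"] by simp
  then show ?case using inv_pair_lift[OF fg(1)] by blast
qed

lemma ex_inv_pair_rotation:
  assumes "q \<in> G"
  shows "\<exists>f g. inv_pair f g \<and> rotation f q"
  using assms
proof induction
  case one
  have "rotation (translate 0) (of_int 0)" by (rule rotation_translate) (rule refl)
  then show ?case using inv_pair_translate[of 0] by auto
next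
  case (incl h)
  then show ?case using ex_inv_pair_rotation_power by blast
next
  case (inv h)
  then obtain f g where "inv_pair f g" "rotation f h" using ex_inv_pair_rotation_power by blast
  then show ?case using rotation_inverse inv_pair_sym unfolding inv_rat_group by blast
next
  case (eng q r)
  then obtain f f' g g' where fg: "inv_pair f f'" "rotation f q" "inv_pair g g'" "rotation g r"
    by blast
  then have "endo f" by (simp add: inv_pair_def)
  from rotation_comp[OF this fg(2,4)] show ?case using inv_pair_comp[OF fg(1,3)] by auto
qed

section \<open>Topology\<close>

lemma openin_full_shift:
  "openin full_shift S \<longleftrightarrow> (\<forall>x\<in>S. \<exists>m. \<forall>y. agree m x y \<longrightarrow> y \<in> S)"
proof
  assume S: "openin full_shift S"
  show "\<forall>x\<in>S. \<exists>m. \<forall>y. agree m x y \<longrightarrow> y \<in> S"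
  proof
    fix x
    assume "x \<in> S"
    then obtain U where U: "finite {i. U i \<noteq> UNIV}" "x \<in> Pi\<^sub>E UNIV U" "Pi\<^sub>E UNIV U \<subseteq> S"
      using S unfolding full_shift_def openin_product_topology_alt by fastforce
    define m where "m = Max (insert 0 (abs ` {i. U i \<noteq> UNIV}))"
    have m: "\<bar>i\<bar> \<le> m" if "U i \<noteq> UNIV" for i
      unfolding m_def using U(1) that by (intro Max_ge) auto
    have "y \<in> S" if y: "agree m x y" for y
    proof -
      have "y i \<in> U i" for i
      proof (cases "U i = UNIV")
        case False
        then have "y i = x i" using m y by (simp add: agree_def)
        then show ?thesis using U(2) by auto
      qed simp
      then show ?thesis using U(3) by auto
    qed
    then show "\<exists>m. \<forall>y. agree m x y \<longrightarrow> y \<in> S" by blast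
  qed
next
  assume S: "\<forall>x\<in>S. \<exists>m. \<forall>y. agree m x y \<longrightarrow> y \<in> S"
  show "openin full_shift S"
    unfolding full_shift_def openin_product_topology_alt
  proof
    fix x
    assume "x \<in> S"
    then obtain m where m: "\<And>y. agree m x y \<Longrightarrow> y \<in> S" using S by blast
    let ?U = "\<lambda>i. if \<bar>i\<bar> \<le> m then {x i} else UNIV"
    have "{i. ?U i \<noteq> UNIV} \<subseteq> {- m..m}" by (auto split: if_splits)
    then have "finite {i. ?U i \<noteq> UNIV}" by (rule finite_subset) simp
    moreover have "Pi\<^sub>E UNIV ?U \<subseteq> S"
    proof
      fix y
      assume "y \<in> Pi\<^sub>E UNIV ?U"
      then have "y i \<in> ?U i" for i by (rule PiE_mem) simp
      then have "agree m x y" unfolding agree_def by (metis singletonD)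
      then show "y \<in> S" by (rule m)
    qed
    ultimately show "\<exists>U. finite {i \<in> UNIV. U i \<noteq> topspace (discrete_topology UNIV)} \<and>
        (\<forall>i\<in>UNIV. openin (discrete_topology UNIV) (U i)) \<and> x \<in> Pi\<^sub>E UNIV U \<and> Pi\<^sub>E UNIV U \<subseteq> S"
      by (intro exI[of _ ?U]) auto
  qed
qed

lemma openin_cylinder: "openin full_shift {y. agree m x y}"
  unfolding openin_full_shift by (auto intro: agree_trans)

lemma openin_subtopology_full_shift:
  "openin (subtopology full_shift Y) V \<longleftrightarrow>
     V \<subseteq> Y \<and> (\<forall>x\<in>V. \<exists>m. \<forall>y\<in>Y. agree m x y \<longrightarrow> y \<in> V)"
proof
  assume "openin (subtopology full_shift Y) V"
  then obtain S where S: "openin full_shift S" "V = S \<inter> Y" by (auto simp: openin_subtopology)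
  then show "V \<subseteq> Y \<and> (\<forall>x\<in>V. \<exists>m. \<forall>y\<in>Y. agree m x y \<longrightarrow> y \<in> V)"
    unfolding openin_full_shift by blast
next
  assume V: "V \<subseteq> Y \<and> (\<forall>x\<in>V. \<exists>m. \<forall>y\<in>Y. agree m x y \<longrightarrow> y \<in> V)"
  \<comment> \<open>The points with a cylinder meeting \<open>Y\<close> only inside \<open>V\<close>
    form an open set whose trace on \<open>Y\<close> is \<open>V\<close>.\<close>
  define S where "S = {z. \<exists>m. (\<forall>y\<in>Y. agree m z y \<longrightarrow> y \<in> V)}"
  have "openin full_shift S"
    unfolding openin_full_shift
  proof
    fix z
    assume "z \<in> S"
    then obtain m where m: "\<And>y. y \<in> Y \<Longrightarrow> agree m z y \<Longrightarrow> y \<in> V" unfolding S_def by blast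
    have "z' \<in> S" if "agree m z z'" for z'
      unfolding S_def using m agree_trans[OF that] by blast
    then show "\<exists>m. \<forall>y. agree m z y \<longrightarrow> y \<in> S" by blast
  qed
  moreover have "V = S \<inter> Y" using V agree_refl unfolding S_def by blast
  ultimately show "openin (subtopology full_shift Y) V" by (auto simp: openin_subtopology)
qed

lemma in_closure_full_shift:
  "x \<in> full_shift closure_of S \<longleftrightarrow> (\<forall>m. \<exists>y\<in>S. agree m x y)"
proof
  assume x: "x \<in> full_shift closure_of S"
  show "\<forall>m. \<exists>y\<in>S. agree m x y"
  proof
    fix m
    have "x \<in> {y. agree m x y}" by simp
    then show "\<exists>y\<in>S. agree m x y" using x openin_cylinder[of m x] unfolding in_closure_of by blast
  qed
next
  assume "\<forall>m. \<exists>y\<in>S. agree m x y"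
  then show "x \<in> full_shift closure_of S"
    unfolding in_closure_of openin_full_shift by (auto; blast)
qed

lemma compact_space_full_shift: "compact_space (full_shift :: (int \<Rightarrow> 'a::finite) topology)"
  by (simp add: full_shift_def compact_space_product_topology compact_space_discrete_topology)

lemma X_eq_closure: "X = full_shift closure_of {translate i xs | i. True}"
proof (rule Set.set_eqI)
  fix x
  show "x \<in> X \<longleftrightarrow> x \<in> full_shift closure_of {translate i xs | i. True}"
    unfolding orbit_closure_def in_closure_full_shift by blast
qed

lemma compactin_X: "compactin full_shift X"
  unfolding X_eq_closure by (rule closedin_compact_space[OF compact_space_full_shift closedin_closure_of])

text \<open>The compactness half of the Curtis--Hedlund--Lyndon theorem.\<close>

lemma endo_if_continuous:
  assumes f: "continuous_map (subtopology full_shift X) (subtopology full_shift X) f"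
    and s: "\<And>x. x \<in> X \<Longrightarrow> f (shift x) = shift (f x)"
  shows "endo f"
proof -
  have fX: "f x \<in> X" if "x \<in> X" for x
    using f that by (auto simp: continuous_map_def)
  have "\<exists>m. \<forall>y\<in>X. agree m x y \<longrightarrow> f y 0 = f x 0" if x: "x \<in> X" for x
  proof -
    have "openin (subtopology full_shift X) {z \<in> X. agree 0 (f x) z}"
      unfolding openin_subtopology_full_shift by (auto intro: agree_trans)
    then have "openin (subtopology full_shift X) {y \<in> X. f y \<in> {z \<in> X. agree 0 (f x) z}}"
      using f by (auto simp: continuous_map_def)
    moreover have "x \<in> {y \<in> X. f y \<in> {z \<in> X. agree 0 (f x) z}}" using x fX by simp
    ultimately obtain m where m: "\<forall>y\<in>X. agree m x y \<longrightarrow> y \<in> {y \<in> X. f y \<in> {z \<in> X. agree 0 (f x) z}}"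
      unfolding openin_subtopology_full_shift by blast
    have "f y 0 = f x 0" if "y \<in> X" "agree m x y" for y
      using m that agreeD[of 0 "f x" "f y" 0] by simp
    then show ?thesis by blast
  qed
  then obtain m where m: "\<And>x y. x \<in> X \<Longrightarrow> y \<in> X \<Longrightarrow> agree (m x) x y \<Longrightarrow> f y 0 = f x 0"
    by metis
  \<comment> \<open>The radius \<open>m x\<close> still depends on \<open>x\<close>; a finite
    subcover by these cylinders makes it uniform.\<close>
  define C where "C x = {y. agree (m x) x y}" for x
  have "X \<subseteq> \<Union> (C ` X)" by (auto simp: C_def)
  then obtain F where F: "finite F" "F \<subseteq> C ` X" "X \<subseteq> \<Union> F"
    using compactin_X openin_cylinder unfolding compactin_def C_def by (metis (no_types, lifting) imageE)
  obtain A where A: "A \<subseteq> X" "finite A" "F = C ` A" using finite_subset_image[OF F(1,2)] by blast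
  define r where "r = Max (m ` A)"
  have "f x 0 = f y 0" if xy: "x \<in> X" "y \<in> X" "agree r x y" for x y
  proof -
    obtain z where z: "z \<in> A" "agree (m z) z x" using F(3) A(3) xy(1) by (auto simp: C_def)
    have "m z \<le> r" unfolding r_def using A(2) z(1) by (intro Max_ge) auto
    then have "agree (m z) z y" using agree_trans[OF z(2) agree_mono[OF xy(3)]] by blast
    then have "f y 0 = f z 0" using m A(1) z(1) xy(2) by blast
    moreover have "f x 0 = f z 0" using m A(1) z xy(1) by blast
    ultimately show ?thesis by simp
  qed
  then have "\<exists>r. \<forall>x\<in>X. \<forall>y\<in>X. agree r x y \<longrightarrow> f x 0 = f y 0" by blast
  then show ?thesis using fX s unfolding endo_def shift_eq_translate by blast
qed

lemma continuous_if_endo: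
  assumes "endo f"
  shows "continuous_map (subtopology full_shift X) (subtopology full_shift X) f"
  unfolding continuous_map_def
proof (intro conjI allI impI)
  show "f \<in> topspace (subtopology full_shift X) \<rightarrow> topspace (subtopology full_shift X)"
    using endo_in_X[OF assms] by auto
  fix U
  assume U: "openin (subtopology full_shift X) U"
  show "openin (subtopology full_shift X) {x \<in> topspace (subtopology full_shift X). f x \<in> U}"
    unfolding openin_subtopology_full_shift
  proof (intro conjI ballI)
    fix x
    assume "x \<in> {x \<in> topspace (subtopology full_shift X). f x \<in> U}"
    then have x: "x \<in> X" "f x \<in> U" by auto
    obtain m where m: "\<And>y. y \<in> X \<Longrightarrow> agree m (f x) y \<Longrightarrow> y \<in> U"
      using U x(2) unfolding openin_subtopology_full_shift by blast
    obtain M where "\<And>x y. x \<in> X \<Longrightarrow> y \<in> X \<Longrightarrow> agree M x y \<Longrightarrow> agree m (f x) (f y)"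
      using endo_agree[OF assms] by metis
    then show "\<exists>m. \<forall>y\<in>X. agree m x y \<longrightarrow> y \<in> {x \<in> topspace (subtopology full_shift X). f x \<in> U}"
      using m x(1) endo_in_X[OF assms] by (intro exI[of _ M]) auto
  qed auto
qed

lemma homeomorphic_maps_if_inv_pair:
  assumes "inv_pair f g"
  shows "homeomorphic_maps (subtopology full_shift X) (subtopology full_shift X) f g"
  using assms by (auto simp: homeomorphic_maps_def inv_pair_def continuous_if_endo)

lemma automorphism_iff_inv_pair:
  "f \<in> automorphisms X \<longleftrightarrow> f \<in> extensional X \<and> (\<exists>g. inv_pair f g)"
proof
  let ?S = "subtopology full_shift X"
  assume "f \<in> automorphisms X"
  then have f: "f \<in> extensional X" "homeomorphic_map ?S ?S f" "\<And>x. x \<in> X \<Longrightarrow> f (shift x) = shift (f x)"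
    by (auto simp: automorphisms_def)
  then obtain g where g: "continuous_map ?S ?S f" "continuous_map ?S ?S g"
    "\<And>x. x \<in> X \<Longrightarrow> g (f x) = x" "\<And>x. x \<in> X \<Longrightarrow> f (g x) = x"
    by (auto simp: homeomorphic_map_maps homeomorphic_maps_def)
  have gX: "g x \<in> X" if "x \<in> X" for x
    using g(2) that by (auto simp: continuous_map_def)
  have "g (shift x) = shift (g x)" if "x \<in> X" for x
  proof -
    have "g (shift x) = g (f (shift (g x)))" using that gX f(3) g(4) by simp
    also have "\<dots> = shift (g x)" using that gX by (intro g(3)) (simp add: shift_eq_translate)
    finally show ?thesis .
  qed
  then have "inv_pair f g"
    using g f(3) by (simp add: inv_pair_def endo_if_continuous)
  then show "f \<in> extensional X \<and> (\<exists>g. inv_pair f g)" using f(1) by blast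
next
  assume "f \<in> extensional X \<and> (\<exists>g. inv_pair f g)"
  then obtain g where f: "f \<in> extensional X" "inv_pair f g" by blast
  then have "endo f" by (simp add: inv_pair_def)
  then show "f \<in> automorphisms X"
    using f homeomorphic_maps_imp_map[OF homeomorphic_maps_if_inv_pair[OF f(2)]]
    by (simp add: automorphisms_def shift_eq_translate endo_translate_commute)
qed

section \<open>The Toeplitz point\<close>

text \<open>An increasing enumeration of the holes turns the counts in \<open>fill\<close> into
  indices. The sign conditions make \<open>e 0\<close> the least nonnegative hole.\<close>

lemma fill_hole_enumeration:
  fixes e :: "int \<Rightarrow> int"
  assumes e: "strict_mono e" "e 0 \<ge> 0" "e (- 1) < 0" and y: "{j. y j = None} = range e"
  shows "fill y z (e k) = z k" "y j \<noteq> None \<Longrightarrow> fill y z j = y j"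
proof -
  have None: "y j = None \<longleftrightarrow> j \<in> range e" for j by (simp flip: y)
  have less: "e i < e j \<longleftrightarrow> i < j" for i j using e(1) by (rule strict_mono_less)
  have le: "e i \<le> e j \<longleftrightarrow> i \<le> j" for i j using e(1) by (rule strict_mono_less_eq)
  have l: "int (LEAST n. y (int n) = None) = e 0"
  proof -
    have "(LEAST n. y (int n) = None) = nat (e 0)"
    proof (rule Least_equality)
      show "y (int (nat (e 0))) = None" unfolding None using e(2) by simp
      fix n
      assume "y (int n) = None"
      then obtain i where i: "int n = e i" using None by blast
      then have "e (- 1) < e i" using e(3) by linarith
      then have "- 1 < i" by (simp only: less)
      then have "e 0 \<le> e i" unfolding le by simp
      then show "nat (e 0) \<le> n" using i by linarith
    qed
    then show ?thesis using e(2) by simp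
  qed
  show "y j \<noteq> None \<Longrightarrow> fill y z j = y j" by (simp add: fill_def Let_def)
  have inj: "inj e" using e(1) by (rule strict_mono_imp_inj_on)
  show "fill y z (e k) = z k"
  proof -
    have None_e: "y (e k) = None" using None by blast
    consider "k = 0" | "k > 0" | "k < 0" by linarith
    then show ?thesis
    proof cases
      case 1
      then show ?thesis using None_e by (simp add: fill_def l)
    next
      case 2
      \<comment> \<open>The count includes the hole \<open>e 0\<close> and stops before
        \<open>e k\<close>, which gives \<open>k\<close>.\<close>
      have "{i \<in> {e 0..e k - 1}. y i = None} = e ` {0..<k}"
      proof -
        have iff: "e 0 \<le> e i \<and> e i \<le> e k - 1 \<longleftrightarrow> 0 \<le> i \<and> i < k" for i
          using le[of 0 i] less[of i k] by linarith
        have "{i. e 0 \<le> e i \<and> e i \<le> e k - 1} = {0..<k}" unfolding iff by auto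
        moreover have "{i \<in> {e 0..e k - 1}. y i = None} = e ` {i. e 0 \<le> e i \<and> e i \<le> e k - 1}"
          by (auto simp: None)
        ultimately show ?thesis by simp
      qed
      then have "card {i \<in> {e 0..e k - 1}. y i = None} = nat k"
        by (simp only: card_image[OF inj_on_subset[OF inj subset_UNIV]] card_atLeastLessThan_int diff_zero)
      moreover have "e k > e 0" using 2 less by blast
      ultimately show ?thesis using 2 None_e unfolding fill_def Let_def l by simp
    next
      case 3
      have "{i \<in> {e k + 1..e 0}. y i = None} = e ` {k<..0}"
      proof -
        have iff: "e k + 1 \<le> e i \<and> e i \<le> e 0 \<longleftrightarrow> k < i \<and> i \<le> 0" for i
          using le[of i 0] less[of k i] by linarith
        have "{i. e k + 1 \<le> e i \<and> e i \<le> e 0} = {k<..0}" unfolding iff by auto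
        moreover have "{i \<in> {e k + 1..e 0}. y i = None} = e ` {i. e k + 1 \<le> e i \<and> e i \<le> e 0}"
          by (auto simp: None)
        ultimately show ?thesis by simp
      qed
      then have "card {i \<in> {e k + 1..e 0}. y i = None} = nat (- k)"
        by (simp only: card_image[OF inj_on_subset[OF inj subset_UNIV]] card_greaterThanAtMost_int diff_0)
      moreover have "e k < e 0" using 3 less by blast
      ultimately show ?thesis using 3 None_e unfolding fill_def Let_def l by simp
    qed
  qed
qed

section \<open>The approximations of the Toeplitz point\<close>

abbreviation pword :: "2 option list" where
  "pword \<equiv> [Some 1, None, Some 0, None, Some 0]"

abbreviation T_opt :: "(int \<Rightarrow> 2 option) \<Rightarrow> int \<Rightarrow> 2 option" where
  "T_opt \<equiv> subst (Some 1) (Some 0)"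

abbreviation "Nones \<equiv> (\<lambda>_. None)"

lemma periodic_point_w: "periodic_point pword = T_opt Nones"
proof
  fix j :: int
  have "j mod 5 = 0 \<or> j mod 5 = 1 \<or> j mod 5 = 2 \<or> j mod 5 = 3 \<or> j mod 5 = 4" by presburger
  then show "periodic_point pword j = T_opt Nones j"
    by (auto simp: periodic_point_def subst_def)
qed

lemma hole_surj:
  assumes "j mod 5 = 1 \<or> j mod 5 = 3"
  shows "hole (2 * j div 5) = j"
  unfolding hole_def by (rule hole_cases[OF assms]) linarith+

lemma strict_mono_hole: "strict_mono hole"
  unfolding strict_mono_def hole_def by (intro allI impI) linarith

lemma funpow_T_opt_hole: "(T_opt ^^ n) y ((hole ^^ n) k) = y k"
  by (induction n arbitrary: k) simp_all

lemma holes_funpow_T_opt: "{j. (T_opt ^^ n) Nones j = None} = range (hole ^^ n)"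
proof (intro equalityI subsetI)
  fix j
  assume "j \<in> {j. (T_opt ^^ n) Nones j = None}"
  then have "(T_opt ^^ n) Nones j = None" by simp
  then show "j \<in> range (hole ^^ n)"
  proof (induction n arbitrary: j)
    case (Suc n)
    then have "T_opt ((T_opt ^^ n) Nones) j = None" by simp
    then have j: "j mod 5 = 1 \<or> j mod 5 = 3" "(T_opt ^^ n) Nones (2 * j div 5) = None"
      unfolding subst_def[of _ _ _ j] by (auto split: if_splits)
    obtain i where "2 * j div 5 = (hole ^^ n) i" using Suc.IH[OF j(2)] by blast
    then have "j = (hole ^^ Suc n) i" using hole_surj[OF j(1)] by simp
    then show ?case by blast
  qed simp
qed (auto simp: funpow_T_opt_hole)

lemma funpow_hole: "strict_mono (hole ^^ n)" "(hole ^^ n) 0 \<ge> 0" "(hole ^^ n) (- 1) < 0"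
proof (induction n)
  case (Suc n)
  { case 1 then show ?case using Suc strict_mono_hole by (simp add: strict_mono_def) }
  { case 2 then show ?case using Suc by (simp add: hole_def) }
  { case 3 then show ?case using Suc by (simp add: hole_def) }
qed (simp_all add: strict_mono_def)

text \<open>Filling the holes of \<open>(T_opt ^^ n) Nones\<close> with \<open>z\<close> yields
  \<open>(T_opt ^^ n) z\<close>, because \<open>hole ^^ n\<close> enumerates those holes. With
  \<open>z = T_opt Nones\<close> this is one further iterate.\<close>

lemma toeplitz_approx_w: "toeplitz_approx pword n = (T_opt ^^ n) Nones"
proof (induction n)
  case (Suc n)
  note fill = fill_hole_enumeration[OF funpow_hole[of n] holes_funpow_T_opt[of n], where z = "T_opt Nones"]
  have comm: "(T_opt ^^ Suc n) Nones = (T_opt ^^ n) (T_opt Nones)" by (simp only: funpow_Suc_right comp_apply)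
  have nonhole: "(T_opt ^^ n) y j = (T_opt ^^ n) Nones j" if "(T_opt ^^ n) Nones j \<noteq> None" for y j n
    using that
  proof (induction n arbitrary: j)
    case (Suc n)
    show ?case
    proof (cases "j mod 5 = 1 \<or> j mod 5 = 3")
      case True
      then show ?thesis using Suc by (simp only: funpow.simps comp_apply subst_at_hole)
    next
      case False
      then show ?thesis unfolding funpow.simps comp_apply by (intro subst_cong) blast
    qed
  qed simp
  have "fill ((T_opt ^^ n) Nones) (T_opt Nones) j = (T_opt ^^ n) (T_opt Nones) j" for j
  proof (cases "(T_opt ^^ n) Nones j = None")
    case True
    then obtain k where "j = (hole ^^ n) k" using holes_funpow_T_opt by blast
    then show ?thesis using fill(1)[of k] by (simp add: funpow_T_opt_hole)
  next
    case False
    then show ?thesis using fill(2)[OF False] nonhole[OF False, of "T_opt Nones"] by (simp only:)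
  qed
  then show ?case unfolding comm toeplitz_approx.simps Suc.IH periodic_point_w by (rule ext)
qed simp

lemma Some_comp_funpow_T: "Some \<circ> (T ^^ n) y = (T_opt ^^ n) (Some \<circ> y)"
proof (induction n)
  case (Suc n)
  have "Some \<circ> T z = T_opt (Some \<circ> z)" for z by (simp add: fun_eq_iff subst_def)
  then show ?case by (simp only: funpow.simps comp_apply Suc.IH)
qed simp

text \<open>\<open>funpow_subst_local\<close> holds over every alphabet; with the hole as a symbol
  it compares the seeds \<open>Nones\<close> and \<open>Some \<circ> xs\<close>.\<close>

lemma toeplitz_approx_eventually:
  assumes "\<bar>j\<bar> < int n"
  shows "toeplitz_approx pword n j = Some (xs j)"
proof -
  have "toeplitz_approx pword n j = (T_opt ^^ n) (Some \<circ> xs) j"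
    unfolding toeplitz_approx_w using assms by (rule funpow_subst_local)
  also have "\<dots> = (Some \<circ> (T ^^ n) xs) j" by (simp only: Some_comp_funpow_T)
  finally show ?thesis by simp
qed

lemma limitin_full_shift_unique:
  assumes "limitin full_shift u x F" "limitin full_shift u y F" "F \<noteq> bot"
  shows "x = y"
proof (rule limitin_Hausdorff_unique[OF assms])
  show "Hausdorff_space full_shift"
    by (simp add: full_shift_def Hausdorff_space_product_topology)
qed

lemma toeplitz_point_w: "toeplitz_point pword = xs"
  unfolding toeplitz_point_def
proof (rule the_equality)
  show lim: "limitin full_shift (toeplitz_approx pword) (Some \<circ> xs) sequentially"
    unfolding limitin_def
  proof (intro conjI allI impI)
    fix U
    assume "openin full_shift U \<and> Some \<circ> xs \<in> U"
    then obtain m where m: "\<And>y. agree m (Some \<circ> xs) y \<Longrightarrow> y \<in> U"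
      unfolding openin_full_shift by blast
    show "\<forall>\<^sub>F n in sequentially. toeplitz_approx pword n \<in> U"
      using eventually_gt_at_top[of "nat m"]
    proof eventually_elim
      case (elim n)
      then show ?case by (intro m) (auto simp: agree_def toeplitz_approx_eventually)
    qed
  qed simp
  show "x = xs" if "limitin full_shift (toeplitz_approx pword) (Some \<circ> x) sequentially" for x
    using limitin_full_shift_unique[OF that lim] by (simp add: fun_eq_iff)
qed

lemma toeplitz_subshift_w: "toeplitz_subshift pword = X"
  by (simp add: toeplitz_subshift_def toeplitz_point_w X_eq_closure translate_def)

section \<open>The isomorphism\<close>

definition rotation_number :: "((int \<Rightarrow> 2) \<Rightarrow> int \<Rightarrow> 2) \<Rightarrow> rat" where
  "rotation_number f = (THE q. rotation f q)"

lemma rotation_number_eq: "rotation f q \<Longrightarrow> rotation_number f = q"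
  unfolding rotation_number_def by (blast intro: the_equality rotation_unique)

text \<open>Additivity is \<open>rotation_comp\<close>. Equal numbers give equal cells, which
  determine an automorphism; surjectivity comes from composing lifts of the shift and their
  inverses.\<close>

lemma rotation_number_iso:
  "rotation_number \<in> iso (aut_group X) (subgroup_generated rat_group {(5 / 2) ^ i | i :: nat. True})"
    (is "_ \<in> iso ?A ?H")
proof -
  have H: "carrier ?H = G" by (simp add: carrier_subgroup_generated)
  have A: "carrier ?A = automorphisms X" by (simp add: aut_group_def)
  have rot: "rotation f (rotation_number f)" "rotation_number f \<in> G" if "f \<in> automorphisms X" for f
    using that ex_rotation rotation_number_eq by (auto simp: automorphism_iff_inv_pair)
  have "rotation_number (f \<otimes>\<^bsub>?A\<^esub> g) = rotation_number f \<otimes>\<^bsub>?H\<^esub> rotation_number g"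
    if f: "f \<in> automorphisms X" and g: "g \<in> automorphisms X" for f g
  proof -
    have e: "endo f" "endo g" using f g by (auto simp: automorphism_iff_inv_pair inv_pair_def)
    have "h \<in> Bij X" if "h \<in> automorphisms X" for h
      using that homeomorphic_imp_injective_map[of "subtopology full_shift X" "subtopology full_shift X" h]
        homeomorphic_imp_surjective_map[of "subtopology full_shift X" "subtopology full_shift X" h]
      by (auto simp: Bij_def bij_betw_def automorphisms_def)
    then have "f \<otimes>\<^bsub>?A\<^esub> g = compose X f g" using f g by (simp add: aut_group_def BijGroup_def)
    moreover have "rotation (compose X f g) (rotation_number f + rotation_number g)"
      by (rule rotation_cong[OF rotation_comp[OF e(1) rot(1)[OF f] rot(1)[OF g]]])
        (simp add: compose_def)
    ultimately show ?thesis by (simp add: rotation_number_eq)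
  qed
  then have "rotation_number \<in> hom ?A ?H"
    by (intro homI) (unfold A H, use rot(2) in blast)+
  moreover have "inj_on rotation_number (automorphisms X)"
  proof (rule inj_onI)
    fix f g
    assume f: "f \<in> automorphisms X" and g: "g \<in> automorphisms X"
      and eq: "rotation_number f = rotation_number g"
    obtain f' where f': "inv_pair f f'" using f by (auto simp: automorphism_iff_inv_pair)
    have "endo g" using g by (auto simp: automorphism_iff_inv_pair inv_pair_def)
    then have "g x = f x" if "x \<in> X" for x
      using endo_determined_by_cells[OF f'] rotation_same_cells[OF rot(1)[OF f]] rot(1)[OF g] eq that
      by auto
    then show "f = g"
      using f g by (intro extensionalityI[of _ X]) (auto simp: automorphism_iff_inv_pair)
  qed
  moreover have "rotation_number ` automorphisms X = G"
  proof (intro equalityI subsetI)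
    fix q
    assume "q \<in> G"
    then obtain f g where fg: "inv_pair f g" "rotation f q" using ex_inv_pair_rotation by blast
    \<comment> \<open>\<open>inv_pair\<close> constrains functions on \<open>X\<close> only;
      restricting makes \<open>f\<close> extensional and keeps its number.\<close>
    define h where "h = restrict f X"
    have h: "h x = f x" if "x \<in> X" for x using that by (simp add: h_def)
    have "endo h" using fg(1) by (intro endo_cong[of f h] h) (simp add: inv_pair_def)
    then have "inv_pair h g" using fg(1) h by (auto simp: inv_pair_def endo_in_X)
    then have "h \<in> automorphisms X" by (auto simp: automorphism_iff_inv_pair h_def)
    moreover have "rotation h q" using fg(2) by (rule rotation_cong) (simp add: h)
    ultimately show "q \<in> rotation_number ` automorphisms X" using rotation_number_eq by force
  qed (use rot(2) in auto)
  ultimately show ?thesis unfolding iso_iff A H by blast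
qed

theorem mainTheorem3:
  fixes w :: "2 option list"
  defines "w \<equiv> [Some 1, None, Some 0, None, Some 0]"
  shows "\<exists>\<Phi> \<in> iso (aut_group (toeplitz_subshift w))
                    (subgroup_generated rat_group {(5/2) ^ i | i :: nat. True}).
           \<Phi> (restrict shift (toeplitz_subshift w)) = 1"
proof (rule bexI)
  have "rotation (restrict shift X) (of_int 1)"
    by (rule rotation_translate) (simp add: shift_eq_translate)
  then show "rotation_number (restrict shift (toeplitz_subshift w)) = 1"
    unfolding w_def toeplitz_subshift_w by (simp add: rotation_number_eq)
  show "rotation_number \<in> iso (aut_group (toeplitz_subshift w))
      (subgroup_generated rat_group {(5/2) ^ i | i :: nat. True})"
    unfolding w_def toeplitz_subshift_w by (rule rotation_number_iso)
qed

end
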